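(* Let $k\ge 1$ and $d\ge 0$. For $d>0$, let $L\subseteq K_k(d)$ be a linear subspace of dimension $\ell_k(d)$ and let $\mathscr R$ be a finite set of homogeneous relations (in the sense of the context). For $d>0$ define $$\mathcal L_{\rm opt}(k,d)=\max\{\tau(M(k,d)),\ \rho_k(d-1)+\tau(\overline M(k,d))\},$$ $$\mathcal L_{\rm eval}(k,d)=\max\{\lambda_{\mathrm{std}}(M(k,d)),\ \rho_k(d-1)+\lambda_{\mathrm{std}}(\overline M(k,d))\},$$ $$\mathcal U(k,d)=\min\{N_k(d)-\ell_k(d),\ \ \mathcal W_k^{(1)}(d)-\delta_{\mathscr R}^{(1)}(k,d),\ \ \rho_k(d-1)+\min(a(k,d),b(k,d))\},$$ where $a(k,d)$ and $b(k,d)$ are the numbers of nonzero rows and of nonzero labelled columns of $\overline M(k,d)$; for $d=0$ put $\mathcal L_{\rm opt}(k,0)=\mathcal L_{\rm eval}(k,0)=\mathcal U(k,0)=0$. Then $$\mathcal L_{\rm eval}(k,d)\le\mathcal L_{\rm opt}(k,d)\le\operatorname{rank}M(k,d)\le\mathcal U(k,d).$$ Consequently, $$N_k(d)-\mathcal U(k,d)\le\dim_{\mathbb F_2}(Q\mathcal P_k)_d\le N_k(d)-\mathcal L_{\rm opt}(k,d)\le N_k(d)-\mathcal L_{\rm eval}(k,d).$$ In degree zero, $\dim_{\mathbb F_2}(Q\mathcal P_k)_0=1$.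
   Context: Setting. $\mathbb N$ includes $0$. $\mathcal P_k=\mathbb F_2[x_1,\dots,x_k]$ with $\deg x_i=1$; $\mathcal P_k^n$ is the degree-$n$ part (zero for $n<0$), $N_k(n)=\dim\mathcal P_k^n$. For $e\in\mathbb N^k$, $x^e=\prod x_i^{e_i}$ and $|e|=\sum e_i$; $\varepsilon_i$ is the $i$th standard vector. The mod-2 Steenrod algebra $\mathcal A$ acts on $\mathcal P_k$ by $\mathrm{Sq}^r(x^a)=\sum_{b\in\mathbb N^k,|b|=r}\prod_i\binom{a_i}{b_i}x^{a+b}$ (mod 2), products in $\mathcal A$ acting by composition, $(\theta\eta)(f)=\theta(\eta(f))$. $\mathcal A^+$ is the augmentation ideal and $Q\mathcal P_k=\mathcal P_k/\mathcal A^+\mathcal P_k$, graded by degree. Hit matrix. $V(k,d)=\bigoplus_{t\ge0,\,2^t\le d}\mathcal P_k^{d-2^t}$ and $\Phi_{k,d}:V(k,d)\to\mathcal P_k^d$, $(g_t)_t\mapsto\sum_t\mathrm{Sq}^{2^t}(g_t)$. $M(k,d)$ is the matrix of $\Phi_{k,d}$ in the monomial bases; its rows are the degree-$d$ monomials and its columns carry labels $(t,g)$ with $g$ a monomial of degree $d-2^t$. First square. $\rho_k(n)=\operatorname{rank}(\mathrm{Sq}^1:\mathcal P_k^n\to\mathcal P_k^{n+1})$. For $e\ne0$ put $i(e)=\min\{i:e_i>0\}$. The linear map $h$ is $h(x^e)=x^{e-\varepsilon_{i(e)}}$ if $e_{i(e)}$ is even, $h(x^e)=0$ if $e_{i(e)}$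 is odd, $h(1)=0$. For $d>0$, $p_d=h\,\mathrm{Sq}^1:\mathcal P_k^d\to\mathcal P_k^d$; its image is the span of the set $\mathcal T_d(k)$ of degree-$d$ monomials whose first positive exponent $e_{i(e)}$ is odd. $\overline M(k,d)$ is the matrix with row basis $\mathcal T_d(k)$ and labelled columns $p_d\mathrm{Sq}^{2^t}(g)$, for $t\ge1$, $2^t\le d$, $g$ a monomial of degree $d-2^t$. Dual kernel. $K_k(d)\subseteq(\mathcal P_k^d)^*$ is $\bigcap_{r>0}\ker \mathrm{Sq}^r_*$, with $\mathrm{Sq}^r_*$ the transpose of $\mathrm{Sq}^r:\mathcal P_k^{d-r}\to\mathcal P_k^d$. Leading rows and acyclic pivots. For a finite matrix $A$ over $\mathbb F_2$, $\operatorname{Supp}(c)$ is the set of rows in which the column $c$ has entry one. For a total order $\prec$ on the rows, $\mathrm{LM}_\prec(c)$ is the largest row in $\operatorname{Supp}(c)$ ($c\neq0$), and $\lambda_\prec(A)=\#\{\mathrm{LM}_\prec(c):c\ne0\}$. Choose a set $C_0$ of nonzero labelled columns and distinct rows $p(c)\in\operatorname{Supp}(c)$, $c\in C_0$; the pivots are acyclic if the directed graph on rows with arrows $r\to p(c)$ for all $c\in C_0$, $r\in\operatorname{Supp}(c)\setminus\{p(c)\}$ has no directed cycle. $\tau(A)$ is the largest possible $|C_0|$ for acyclic pivots. $\lambda_{\rm std}(A)$ is the maximum of $\lambda_\prec(A)$ over the following four orders on monomials of degree $d$ (restricted to the rows of $A$): (i) exponent lexicographic: at the first differing exponent, the larger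 exponent gives the larger monomial; (ii) degree-reverse-lexicographic: at the last differing exponent, the larger exponent gives the smaller monomial; (iii) left weight: with $\omega_j(e)$ the number of indices $i$ such that the binary digit of $e_i$ at position $j-1$ is one ($j\ge1$, position $0$ is the units digit), at the smallest $j$ where the weights differ the larger $\omega_j$ gives the larger monomial, ties broken by (i); (iv) right weight: at the largest $j$ where the weights differ the larger $\omega_j$ gives the smaller monomial, ties broken by (i). Maxima over empty families are zero. Relations. A homogeneous relation of degree $a>0$ is a finitely supported tuple $\Theta=(\Theta_t)_{t\ge0}$ of homogeneous elements of $\mathcal A$, with $|\Theta_t|=a-2^t$ for nonzero entries, such that $\sum_t\mathrm{Sq}^{2^t}\Theta_t=0$ in $\mathcal A$. For $d\ge a$, $\Psi_{\Theta,d}:\mathcal P_k^{d-a}\to V(k,d)$ sends $f$ to $(\Theta_t(f))_t$; its image is set to zero when $d<a$. $E_0\subseteq V(k,d)$ is the coordinate subspace spanned by labels $(t,g)$ with $\mathrm{Sq}^{2^t}(g)=0$. $\Theta^{(1)}$ is the relation of degree $2$ with only nonzero entry $\Theta_0=\mathrm{Sq}^1$ (from $\mathrm{Sq}^1\mathrm{Sq}^1=0$). Put $F_1=E_0+\operatorname{im}\Psi_{\Theta^{(1)},d}$, $K_{\mathscr R}=\sum_{\Theta\in\mathscr R}\operatorname{im}\Psi_{\Theta,d}$, and $\delta^{(1)}_{\mathscr R}(k,d)=\dim(F_1+K_{\mathscr R})-\dim F_1$. Column count. $Z_t(k,S)$ is the number of degree-$S$ monomials $g$ in $\mathcal P_k$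 with $\mathrm{Sq}^{2^t}(g)=0$ (zero for $S<0$). For $d\ge1$, $\mathcal W_k^{(1)}(d)=\rho_k(d-1)+\sum_{t\ge1,\,2^t\le d}\bigl(N_k(d-2^t)-Z_t(k,d-2^t)\bigr)$. *)

theory Defs
  imports Complex_Main "HOL-Library.Poly_Mapping" "HOL-Library.Z2" "HOL-Library.Function_Algebras"
begin

section \<open>Vector spaces over the field with two elements\<close>

text \<open>
  The field is the type \<^typ>\<open>bit\<close>. An abelian group carries at most one structure of vector
  space over it, and carries one iff every element is its own inverse. This class collects those
  groups, so that a single interpretation of the locale \<^locale>\<open>vector_space\<close> provides
  span, subspace and dimension for all spaces below.
\<close>

class f2_space = ab_group_add +
  assumes add_self [simp]: "x + x = 0"

definition bscale :: "bit \<Rightarrow> 'a::f2_space \<Rightarrow> 'a" where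
  "bscale c x = (if c = 1 then x else 0)"

interpretation F2: vector_space "bscale :: bit \<Rightarrow> 'a::f2_space \<Rightarrow> 'a"
proof
  fix a b :: bit and x y :: 'a
  show "bscale a (x + y) = bscale a x + bscale a y" by (simp add: bscale_def)
  show "bscale (a + b) x = bscale a x + bscale b x"
    by (cases a; cases b) (simp_all add: bscale_def)
  show "bscale a (bscale b x) = bscale (a * b) x"
    by (cases a; cases b) (simp_all add: bscale_def)
  show "bscale 1 x = x" by (simp add: bscale_def)
qed

instance bit :: f2_space
proof
  fix x :: bit show "x + x = 0" by (cases x) simp_all
qed

instance poly_mapping :: (type, f2_space) f2_space
  by standard (rule poly_mapping_eqI, simp add: lookup_add)

instance "fun" :: (type, f2_space) f2_space
  by standard (simp add: fun_eq_iff)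

lemma f2_uminus: "- x = (x :: 'a::f2_space)"
  using add_self by (rule minus_unique)

lemma f2_minus: "x - y = x + (y :: 'a::f2_space)"
  by (simp only: diff_conv_add_uminus f2_uminus)

lemma f2_minus_swap: "x - y = y - (x :: 'a::f2_space)"
  by (simp only: f2_minus add.commute)

section \<open>Polynomials and Steenrod squares\<close>

text \<open>
  The variables are indexed by a finite linearly ordered type \<open>'k\<close> with
  \<open>k = CARD('k)\<close> elements, so that \<open>k \<ge> 1\<close> is arbitrary. The order of \<open>'k\<close> is the
  order \<open>1 < \<dots> < k\<close> of the variables. A monomial is given by its exponent vector.
\<close>

type_synonym 'k mon = "'k \<Rightarrow>\<^sub>0 nat"
type_synonym 'k mpol = "'k mon \<Rightarrow>\<^sub>0 bit"

abbreviation expo :: "'k mon \<Rightarrow> 'k \<Rightarrow> nat" where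
  "expo \<equiv> Poly_Mapping.lookup"

definition xpow :: "'k mon \<Rightarrow> 'k mpol" where
  "xpow e = Poly_Mapping.single e 1"

definition mdeg :: "'k::finite mon \<Rightarrow> nat" where
  "mdeg e = (\<Sum>i\<in>UNIV. expo e i)"

lemma finite_mdeg: "finite {e :: 'k::finite mon. mdeg e = n}"
proof (rule finite_imageD)
  have "expo e i \<le> mdeg e" for e :: "'k mon" and i
    unfolding mdeg_def by (rule member_le_sum) simp_all
  then have "expo ` {e :: 'k mon. mdeg e = n} \<subseteq> {f. \<forall>i. (i \<in> UNIV \<longrightarrow> f i \<in> {..n}) \<and> (i \<notin> UNIV \<longrightarrow> f i = 0)}"
    by auto
  then show "finite (expo ` {e :: 'k mon. mdeg e = n})"
    by (rule finite_subset) (intro finite_set_of_finite_funs finite finite_atMost)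
  show "inj_on expo {e :: 'k mon. mdeg e = n}"
    by (simp add: inj_on_def poly_mapping_eqI)
qed

definition homog :: "nat \<Rightarrow> 'k::finite mpol set" where
  "homog n = {f. \<forall>e\<in>Poly_Mapping.keys f. mdeg e = n}"

definition dimP :: "'k::finite itself \<Rightarrow> nat \<Rightarrow> nat" where
  "dimP _ n = F2.dim (homog n :: 'k mpol set)"

definition lin_ext :: "('a \<Rightarrow> 'b::f2_space) \<Rightarrow> ('a \<Rightarrow>\<^sub>0 bit) \<Rightarrow> 'b" where
  "lin_ext F f = (\<Sum>e\<in>Poly_Mapping.keys f. bscale (Poly_Mapping.lookup f e) (F e))"

definition Sq :: "nat \<Rightarrow> 'k::finite mpol \<Rightarrow> 'k mpol" where
  "Sq r = lin_ext (\<lambda>a. \<Sum>b | mdeg b = r.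
     Poly_Mapping.single (a + b) (of_nat (\<Prod>i\<in>UNIV. expo a i choose expo b i)))"

section \<open>The Steenrod algebra\<close>

text \<open>
  Words are lists of natural numbers under concatenation, so that \<^typ>\<open>nat list \<Rightarrow>\<^sub>0 bit\<close> is the
  free associative algebra on generators \<open>Sq\<^sup>0, Sq\<^sup>1, \<dots>\<close>. The Steenrod algebra is its quotient
  by \<open>Sq\<^sup>0 = 1\<close> and the Adem relations.
\<close>

instantiation list :: (type) monoid_add
begin

definition zero_list :: "'a list" where "zero_list = []"
definition plus_list :: "'a list \<Rightarrow> 'a list \<Rightarrow> 'a list" where "plus_list = append"

instance by standard (simp_all add: zero_list_def plus_list_def)

end

type_synonym free_sq = "nat list \<Rightarrow>\<^sub>0 bit"

definition gen_sq :: "nat \<Rightarrow> free_sq" where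
  "gen_sq r = Poly_Mapping.single [r] 1"

definition adem :: "nat \<Rightarrow> nat \<Rightarrow> free_sq" where
  "adem a b = gen_sq a * gen_sq b -
     (\<Sum>j\<le>a div 2. of_nat ((b - 1 - j) choose (a - 2 * j)) * (gen_sq (a + b - j) * gen_sq j))"

definition steenrod_relators :: "free_sq set" where
  "steenrod_relators = insert (gen_sq 0 - 1) {adem a b | a b. 0 < a \<and> a < 2 * b}"

definition steenrod_ideal :: "free_sq set" where
  "steenrod_ideal = F2.span {u * r * v | u r v. r \<in> steenrod_relators}"

lemma steenrod_ideal_mult_left: "x \<in> steenrod_ideal \<Longrightarrow> y * x \<in> steenrod_ideal"
  unfolding steenrod_ideal_def
proof (induction rule: F2.span_induct_alt)
  case base
  show ?case by (simp add: F2.span_zero)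
next
  case (step c x z)
  from step.hyps obtain u r v where x: "x = u * r * v" and r: "r \<in> steenrod_relators"
    by (elim CollectE exE conjE)
  have "y * x = (y * u) * r * v" by (simp only: x mult.assoc)
  with r have "y * x \<in> F2.span {u * r * v | u r v. r \<in> steenrod_relators}"
    by (intro F2.span_base CollectI exI conjI)
  then have "bscale c (y * x) + y * z \<in> F2.span {u * r * v | u r v. r \<in> steenrod_relators}"
    by (intro F2.span_add F2.span_scale step.IH)
  moreover have "bscale c (y * x) + y * z = y * (bscale c x + z)"
    by (cases "c = 1") (simp_all add: bscale_def algebra_simps)
  ultimately show ?case by (simp only:)
qed

lemma steenrod_ideal_mult_right: "x \<in> steenrod_ideal \<Longrightarrow> x * y \<in> steenrod_ideal"
  unfolding steenrod_ideal_def
proof (induction rule: F2.span_induct_alt)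
  case base
  show ?case by (simp add: F2.span_zero)
next
  case (step c x z)
  from step.hyps obtain u r v where x: "x = u * r * v" and r: "r \<in> steenrod_relators"
    by (elim CollectE exE conjE)
  have "x * y = u * r * (v * y)" by (simp only: x mult.assoc)
  with r have "x * y \<in> F2.span {u * r * v | u r v. r \<in> steenrod_relators}"
    by (intro F2.span_base CollectI exI conjI)
  then have "bscale c (x * y) + z * y \<in> F2.span {u * r * v | u r v. r \<in> steenrod_relators}"
    by (intro F2.span_add F2.span_scale step.IH)
  moreover have "bscale c (x * y) + z * y = (bscale c x + z) * y"
    by (cases "c = 1") (simp_all add: bscale_def algebra_simps)
  ultimately show ?case by (simp only:)
qed

lemma steenrod_ideal_zero: "0 \<in> steenrod_ideal"
  by (simp add: steenrod_ideal_def F2.span_zero)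

lemma steenrod_ideal_add: "x \<in> steenrod_ideal \<Longrightarrow> y \<in> steenrod_ideal \<Longrightarrow> x + y \<in> steenrod_ideal"
  by (simp add: steenrod_ideal_def F2.span_add)

quotient_type steenrod = free_sq / "\<lambda>x y. x - y \<in> steenrod_ideal"
proof (rule equivpI)
  show "reflp (\<lambda>x y. x - y \<in> steenrod_ideal)"
    by (simp add: reflp_def steenrod_ideal_zero)
  show "symp (\<lambda>x y. x - y \<in> steenrod_ideal)"
    unfolding symp_def using f2_minus_swap by metis
  show "transp (\<lambda>x y. x - y \<in> steenrod_ideal)"
  proof (rule transpI)
    fix x y z :: free_sq
    assume "x - y \<in> steenrod_ideal" "y - z \<in> steenrod_ideal"
    then have "(x - y) + (y - z) \<in> steenrod_ideal" by (rule steenrod_ideal_add)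
    then show "x - z \<in> steenrod_ideal" by simp
  qed
qed

instantiation steenrod :: ring
begin

lift_definition zero_steenrod :: steenrod is 0 .

lift_definition plus_steenrod :: "steenrod \<Rightarrow> steenrod \<Rightarrow> steenrod" is "(+)"
proof -
  fix x y u v :: free_sq
  assume "x - y \<in> steenrod_ideal" "u - v \<in> steenrod_ideal"
  then have "(x - y) + (u - v) \<in> steenrod_ideal" by (rule steenrod_ideal_add)
  then show "(x + u) - (y + v) \<in> steenrod_ideal" by (simp add: algebra_simps)
qed

lift_definition minus_steenrod :: "steenrod \<Rightarrow> steenrod \<Rightarrow> steenrod" is "(-)"
proof -
  fix x y u v :: free_sq
  assume "x - y \<in> steenrod_ideal" "u - v \<in> steenrod_ideal"
  then have "(x - y) + (v - u) \<in> steenrod_ideal"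
    by (subst f2_minus_swap [of v u]) (rule steenrod_ideal_add)
  then show "(x - u) - (y - v) \<in> steenrod_ideal" by (simp add: algebra_simps)
qed

lift_definition uminus_steenrod :: "steenrod \<Rightarrow> steenrod" is uminus
  by (simp only: f2_uminus)

lift_definition times_steenrod :: "steenrod \<Rightarrow> steenrod \<Rightarrow> steenrod" is "(*)"
proof -
  fix x y u v :: free_sq
  assume "x - y \<in> steenrod_ideal" "u - v \<in> steenrod_ideal"
  then have "(x - y) * u + y * (u - v) \<in> steenrod_ideal"
    by (intro steenrod_ideal_add steenrod_ideal_mult_left steenrod_ideal_mult_right)
  moreover have "(x - y) * u + y * (u - v) = x * u - y * v"
    by (simp add: algebra_simps)
  ultimately show "x * u - y * v \<in> steenrod_ideal" by simp
qed

instance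
proof
  fix a b c :: steenrod
  show "a + b + c = a + (b + c)"
    by transfer (simp add: add.assoc steenrod_ideal_zero)
  show "a + b = b + a"
    by transfer (simp add: add.commute steenrod_ideal_zero)
  show "0 + a = a"
    by transfer (simp add: steenrod_ideal_zero)
  show "- a + a = 0"
    by transfer (simp add: steenrod_ideal_zero)
  show "a - b = a + - b"
    by transfer (simp add: steenrod_ideal_zero)
  show "a * b * c = a * (b * c)"
    by transfer (simp add: mult.assoc steenrod_ideal_zero)
  show "(a + b) * c = a * c + b * c"
    by transfer (simp add: distrib_right steenrod_ideal_zero)
  show "a * (b + c) = a * b + a * c"
    by transfer (simp add: distrib_left steenrod_ideal_zero)
qed

end

instance steenrod :: f2_space
proof
  fix x :: steenrod
  show "x + x = 0" by transfer (simp add: steenrod_ideal_zero)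
qed

definition SqA :: "nat \<Rightarrow> steenrod" where
  "SqA r = abs_steenrod (gen_sq r)"

definition steenrod_homog :: "nat \<Rightarrow> steenrod set" where
  "steenrod_homog n = abs_steenrod ` {x. \<forall>w\<in>Poly_Mapping.keys x. sum_list w = n}"

definition augmentation_ideal :: "steenrod set" where
  "augmentation_ideal = F2.span (\<Union>n\<in>{0<..}. steenrod_homog n)"

text \<open>
  The word \<open>[r\<^sub>1, \<dots>, r\<^sub>m]\<close> acts as the composite \<open>Sq\<^bsup>r\<^sub>1\<^esup> \<circ> \<dots> \<circ> Sq\<^bsup>r\<^sub>m\<^esup>\<close>. A class in the Steenrod
  algebra acts through a representative; the choice is immaterial since the operators \<^const>\<open>Sq\<close>
  on polynomials satisfy the Adem relations.
\<close>

definition free_act :: "free_sq \<Rightarrow> 'k::finite mpol \<Rightarrow> 'k mpol" where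
  "free_act x f = lin_ext (\<lambda>w. foldr Sq w f) x"

definition act :: "steenrod \<Rightarrow> 'k::finite mpol \<Rightarrow> 'k mpol" where
  "act \<theta> = free_act (rep_steenrod \<theta>)"

section \<open>The cohit module\<close>

definition hits :: "'k::finite mpol set" where
  "hits = F2.span {act \<theta> f | \<theta> f. \<theta> \<in> augmentation_ideal}"

lemma hits_zero: "0 \<in> hits"
  by (simp add: hits_def F2.span_zero)

lemma hits_add: "f \<in> hits \<Longrightarrow> g \<in> hits \<Longrightarrow> f + g \<in> hits"
  by (simp add: hits_def F2.span_add)

quotient_type 'k cohits = "'k::finite mpol" / "\<lambda>f g. f - g \<in> hits"
proof (rule equivpI)
  show "reflp (\<lambda>f g :: 'k mpol. f - g \<in> hits)"
    by (simp add: reflp_def hits_zero)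
  show "symp (\<lambda>f g :: 'k mpol. f - g \<in> hits)"
    unfolding symp_def using f2_minus_swap by metis
  show "transp (\<lambda>f g :: 'k mpol. f - g \<in> hits)"
  proof (rule transpI)
    fix x y z :: "'k mpol"
    assume "x - y \<in> hits" "y - z \<in> hits"
    then have "(x - y) + (y - z) \<in> hits" by (rule hits_add)
    then show "x - z \<in> hits" by simp
  qed
qed

instantiation cohits :: (finite) f2_space
begin

lift_definition zero_cohits :: "'a cohits" is 0 .

lift_definition plus_cohits :: "'a cohits \<Rightarrow> 'a cohits \<Rightarrow> 'a cohits" is "(+)"
proof -
  fix x y u v :: "'a mpol"
  assume "x - y \<in> hits" "u - v \<in> hits"
  then have "(x - y) + (u - v) \<in> hits" by (rule hits_add)
  then show "(x + u) - (y + v) \<in> hits" by (simp add: algebra_simps)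
qed

lift_definition minus_cohits :: "'a cohits \<Rightarrow> 'a cohits \<Rightarrow> 'a cohits" is "(-)"
proof -
  fix x y u v :: "'a mpol"
  assume "x - y \<in> hits" "u - v \<in> hits"
  then have "(x - y) + (v - u) \<in> hits"
    by (subst f2_minus_swap [of v u]) (rule hits_add)
  then show "(x - u) - (y - v) \<in> hits" by (simp add: algebra_simps)
qed

lift_definition uminus_cohits :: "'a cohits \<Rightarrow> 'a cohits" is uminus
  by (simp only: f2_uminus)

instance
proof
  fix a b c :: "'a cohits"
  show "a + b + c = a + (b + c)"
    by transfer (simp add: add.assoc hits_zero)
  show "a + b = b + a"
    by transfer (simp add: add.commute hits_zero)
  show "0 + a = a"
    by transfer (simp add: hits_zero)
  show "- a + a = 0"
    by transfer (simp add: hits_zero)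
  show "a - b = a + - b"
    by transfer (simp add: hits_zero)
  show "a + a = 0"
    by transfer (simp add: hits_zero)
qed

end

definition cohits_deg :: "nat \<Rightarrow> 'k::finite cohits set" where
  "cohits_deg d = abs_cohits ` homog d"

section \<open>Labelled matrices\<close>

record ('r, 'c) lmatrix =
  rows :: "'r set"
  cols :: "'c set"
  entry :: "'r \<Rightarrow> 'c \<Rightarrow> bit"

definition mat_col :: "('r, 'c) lmatrix \<Rightarrow> 'c \<Rightarrow> ('r \<Rightarrow>\<^sub>0 bit)" where
  "mat_col A c = (\<Sum>r\<in>rows A. Poly_Mapping.single r (entry A r c))"

definition mat_rank :: "('r, 'c) lmatrix \<Rightarrow> nat" where
  "mat_rank A = F2.dim (F2.span (mat_col A ` cols A))"

definition Supp :: "('r, 'c) lmatrix \<Rightarrow> 'c \<Rightarrow> 'r set" where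
  "Supp A c = {r \<in> rows A. entry A r c = 1}"

definition nonzero_cols :: "('r, 'c) lmatrix \<Rightarrow> 'c set" where
  "nonzero_cols A = {c \<in> cols A. Supp A c \<noteq> {}}"

definition nonzero_rows :: "('r, 'c) lmatrix \<Rightarrow> 'r set" where
  "nonzero_rows A = {r \<in> rows A. \<exists>c\<in>cols A. entry A r c \<noteq> 0}"

definition LM :: "('r \<Rightarrow> 'r \<Rightarrow> bool) \<Rightarrow> ('r, 'c) lmatrix \<Rightarrow> 'c \<Rightarrow> 'r" where
  "LM prec A c = (THE r. r \<in> Supp A c \<and> (\<forall>s\<in>Supp A c. s \<noteq> r \<longrightarrow> prec s r))"

definition lead_count :: "('r \<Rightarrow> 'r \<Rightarrow> bool) \<Rightarrow> ('r, 'c) lmatrix \<Rightarrow> nat" where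
  "lead_count prec A = card (LM prec A ` nonzero_cols A)"

definition acyclic_pivots :: "('r, 'c) lmatrix \<Rightarrow> 'c set \<Rightarrow> ('c \<Rightarrow> 'r) \<Rightarrow> bool" where
  "acyclic_pivots A C p \<longleftrightarrow>
     C \<subseteq> nonzero_cols A \<and> inj_on p C \<and> (\<forall>c\<in>C. p c \<in> Supp A c) \<and>
     acyclic {(r, p c) | r c. c \<in> C \<and> r \<in> Supp A c - {p c}}"

definition tau :: "('r, 'c) lmatrix \<Rightarrow> nat" where
  "tau A = Max {card C | C. \<exists>p. acyclic_pivots A C p}"

section \<open>The four standard orders\<close>

text \<open>Each predicate reads: the first monomial is strictly smaller than the second.\<close>

definition lex_less :: "'k::linorder mon \<Rightarrow> 'k mon \<Rightarrow> bool" where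
  "lex_less a b \<longleftrightarrow> (\<exists>i. (\<forall>j<i. expo a j = expo b j) \<and> expo a i < expo b i)"

definition degrevlex_less :: "'k::linorder mon \<Rightarrow> 'k mon \<Rightarrow> bool" where
  "degrevlex_less a b \<longleftrightarrow> (\<exists>i. (\<forall>j>i. expo a j = expo b j) \<and> expo a i > expo b i)"

definition weight :: "nat \<Rightarrow> 'k::finite mon \<Rightarrow> nat" where
  "weight j e = card {i. odd (expo e i div 2 ^ (j - 1))}"

definition left_weight_less :: "'k::{finite,linorder} mon \<Rightarrow> 'k mon \<Rightarrow> bool" where
  "left_weight_less a b \<longleftrightarrow>
     (\<exists>j\<ge>1. (\<forall>i. 1 \<le> i \<and> i < j \<longrightarrow> weight i a = weight i b) \<and> weight j a < weight j b) \<or>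
     (\<forall>j\<ge>1. weight j a = weight j b) \<and> lex_less a b"

definition right_weight_less :: "'k::{finite,linorder} mon \<Rightarrow> 'k mon \<Rightarrow> bool" where
  "right_weight_less a b \<longleftrightarrow>
     (\<exists>j\<ge>1. (\<forall>i>j. weight i a = weight i b) \<and> weight j a > weight j b) \<or>
     (\<forall>j\<ge>1. weight j a = weight j b) \<and> lex_less a b"

definition lead_std :: "('k::{finite,linorder} mon, 'c) lmatrix \<Rightarrow> nat" where
  "lead_std A = Max {lead_count lex_less A, lead_count degrevlex_less A,
     lead_count left_weight_less A, lead_count right_weight_less A}"

section \<open>The hit matrix and its first-square reduction\<close>

text \<open>
  An element of \<open>V(k,d)\<close> is a finitely supported family of polynomials indexed by \<open>t\<close>;
  the label \<open>(t, g)\<close> denotes the basis element with entry \<open>g\<close> at \<open>t\<close>.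
\<close>

definition hit_domain :: "nat \<Rightarrow> (nat \<Rightarrow>\<^sub>0 'k::finite mpol) set" where
  "hit_domain d = {v. \<forall>t. Poly_Mapping.lookup v t \<in> (if 2 ^ t \<le> d then homog (d - 2 ^ t) else {0})}"

definition labels :: "nat \<Rightarrow> (nat \<times> 'k::finite mon) set" where
  "labels d = {(t, g). 2 ^ t \<le> d \<and> mdeg g = d - 2 ^ t}"

definition label_vec :: "nat \<times> 'k mon \<Rightarrow> (nat \<Rightarrow>\<^sub>0 'k mpol)" where
  "label_vec = (\<lambda>(t, g). Poly_Mapping.single t (xpow g))"

definition hit_map :: "(nat \<Rightarrow>\<^sub>0 'k::finite mpol) \<Rightarrow> 'k mpol" where
  "hit_map v = (\<Sum>t\<in>Poly_Mapping.keys v. Sq (2 ^ t) (Poly_Mapping.lookup v t))"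

definition hit_matrix :: "nat \<Rightarrow> ('k::finite mon, nat \<times> 'k mon) lmatrix" where
  "hit_matrix d = \<lparr>rows = {e. mdeg e = d}, cols = labels d,
          entry = (\<lambda>e c. Poly_Mapping.lookup (hit_map (label_vec c)) e)\<rparr>"

definition rho :: "'k::finite itself \<Rightarrow> nat \<Rightarrow> nat" where
  "rho _ n = F2.dim (Sq 1 ` (homog n :: 'k mpol set))"

definition first_idx :: "'k::{finite,linorder} mon \<Rightarrow> 'k" where
  "first_idx e = Min {i. expo e i > 0}"

definition h_map :: "'k::{finite,linorder} mpol \<Rightarrow> 'k mpol" where
  "h_map = lin_ext (\<lambda>e. if e \<noteq> 0 \<and> even (expo e (first_idx e))
                    then xpow (e - Poly_Mapping.single (first_idx e) 1) else 0)"

definition p_map :: "'k::{finite,linorder} mpol \<Rightarrow> 'k mpol" where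
  "p_map f = h_map (Sq 1 f)"

definition first_odd :: "nat \<Rightarrow> 'k::{finite,linorder} mon set" where
  "first_odd d = {e. mdeg e = d \<and> e \<noteq> 0 \<and> odd (expo e (first_idx e))}"

definition reduced_matrix :: "nat \<Rightarrow> ('k::{finite,linorder} mon, nat \<times> 'k mon) lmatrix" where
  "reduced_matrix d = \<lparr>rows = first_odd d, cols = {(t, g) \<in> labels d. 1 \<le> t},
             entry = (\<lambda>e (t, g). Poly_Mapping.lookup (p_map (Sq (2 ^ t) (xpow g))) e)\<rparr>"

section \<open>The dual kernel\<close>

text \<open>
  Functionals on the degree-\<open>n\<close> part are functions on all polynomials, made unique by the value
  zero outside that part.
\<close>

definition dual :: "nat \<Rightarrow> ('k::finite mpol \<Rightarrow> bit) set" where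
  "dual n = {\<phi>. (\<forall>f\<in>homog n. \<forall>g\<in>homog n. \<phi> (f + g) = \<phi> f + \<phi> g) \<and>
                (\<forall>c. \<forall>f\<in>homog n. \<phi> (bscale c f) = c * \<phi> f) \<and>
                (\<forall>f. f \<notin> homog n \<longrightarrow> \<phi> f = 0)}"

definition Sq_dual :: "nat \<Rightarrow> nat \<Rightarrow> ('k::finite mpol \<Rightarrow> bit) \<Rightarrow> ('k mpol \<Rightarrow> bit)" where
  "Sq_dual d r \<phi> = (\<lambda>f. if r \<le> d \<and> f \<in> homog (d - r) then \<phi> (Sq r f) else 0)"

definition dual_kernel :: "nat \<Rightarrow> ('k::finite mpol \<Rightarrow> bit) set" where
  "dual_kernel d = {\<phi> \<in> dual d. \<forall>r>0. Sq_dual d r \<phi> = 0}"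

section \<open>Relations\<close>

text \<open>
  A relation is kept together with its degree, which the tuple determines only when it is nonzero.
  Sums of subspaces are spans of unions.
\<close>

definition homogeneous_relation :: "nat \<Rightarrow> (nat \<Rightarrow>\<^sub>0 steenrod) \<Rightarrow> bool" where
  "homogeneous_relation a \<Theta> \<longleftrightarrow> 0 < a \<and>
     (\<forall>t\<in>Poly_Mapping.keys \<Theta>. 2 ^ t \<le> a \<and> Poly_Mapping.lookup \<Theta> t \<in> steenrod_homog (a - 2 ^ t)) \<and>
     (\<Sum>t\<in>Poly_Mapping.keys \<Theta>. SqA (2 ^ t) * Poly_Mapping.lookup \<Theta> t) = 0"

definition Psi_map :: "(nat \<Rightarrow>\<^sub>0 steenrod) \<Rightarrow> 'k::finite mpol \<Rightarrow> (nat \<Rightarrow>\<^sub>0 'k mpol)" where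
  "Psi_map \<Theta> f = Poly_Mapping.map (\<lambda>\<theta>. act \<theta> f) \<Theta>"

definition im_Psi :: "nat \<Rightarrow> nat \<times> (nat \<Rightarrow>\<^sub>0 steenrod) \<Rightarrow> (nat \<Rightarrow>\<^sub>0 'k::finite mpol) set" where
  "im_Psi d = (\<lambda>(a, \<Theta>). if a \<le> d then Psi_map \<Theta> ` homog (d - a) else {0})"

definition E0 :: "nat \<Rightarrow> (nat \<Rightarrow>\<^sub>0 'k::finite mpol) set" where
  "E0 d = F2.span (label_vec ` {(t, g) \<in> labels d. Sq (2 ^ t) (xpow g) = 0})"

definition Theta1 :: "nat \<Rightarrow>\<^sub>0 steenrod" where
  "Theta1 = Poly_Mapping.single 0 (SqA 1)"

definition F1 :: "nat \<Rightarrow> (nat \<Rightarrow>\<^sub>0 'k::finite mpol) set" where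
  "F1 d = F2.span (E0 d \<union> im_Psi d (2, Theta1))"

definition K_rel :: "(nat \<times> (nat \<Rightarrow>\<^sub>0 steenrod)) set \<Rightarrow> nat \<Rightarrow> (nat \<Rightarrow>\<^sub>0 'k::finite mpol) set" where
  "K_rel R d = F2.span (\<Union>\<Theta>\<in>R. im_Psi d \<Theta>)"

definition delta1 :: "'k::finite itself \<Rightarrow> (nat \<times> (nat \<Rightarrow>\<^sub>0 steenrod)) set \<Rightarrow> nat \<Rightarrow> int" where
  "delta1 _ R d = int (F2.dim (F2.span (F1 d \<union> K_rel R d :: (nat \<Rightarrow>\<^sub>0 'k mpol) set)))
                  - int (F2.dim (F1 d :: (nat \<Rightarrow>\<^sub>0 'k mpol) set))"

definition zero_count :: "'k::finite itself \<Rightarrow> nat \<Rightarrow> nat \<Rightarrow> nat" where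
  "zero_count _ t S = card {g :: 'k mon. mdeg g = S \<and> Sq (2 ^ t) (xpow g) = 0}"

definition W1 :: "'k::finite itself \<Rightarrow> nat \<Rightarrow> int" where
  "W1 k d = int (rho k (d - 1)) +
     (\<Sum>t | 1 \<le> t \<and> 2 ^ t \<le> d. int (dimP k (d - 2 ^ t)) - int (zero_count k t (d - 2 ^ t)))"

section \<open>The bounds\<close>

definition L_opt :: "'k::{finite,linorder} itself \<Rightarrow> nat \<Rightarrow> nat" where
  "L_opt k d = (if d = 0 then 0
     else max (tau (hit_matrix d :: ('k mon, nat \<times> 'k mon) lmatrix))
              (rho k (d - 1) + tau (reduced_matrix d :: ('k mon, nat \<times> 'k mon) lmatrix)))"

definition L_eval :: "'k::{finite,linorder} itself \<Rightarrow> nat \<Rightarrow> nat" where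
  "L_eval k d = (if d = 0 then 0
     else max (lead_std (hit_matrix d :: ('k mon, nat \<times> 'k mon) lmatrix))
              (rho k (d - 1) + lead_std (reduced_matrix d :: ('k mon, nat \<times> 'k mon) lmatrix)))"

definition U_bound :: "('k::{finite,linorder} mpol \<Rightarrow> bit) set \<Rightarrow>
    (nat \<times> (nat \<Rightarrow>\<^sub>0 steenrod)) set \<Rightarrow> nat \<Rightarrow> int" where
  "U_bound L R d = (if d = 0 then 0
     else Min {int (dimP TYPE('k) d) - int (F2.dim L),
               W1 TYPE('k) d - delta1 TYPE('k) R d,
               int (rho TYPE('k) (d - 1)) +
                 int (min (card (nonzero_rows (reduced_matrix d :: ('k mon, nat \<times> 'k mon) lmatrix)))
                          (card (nonzero_cols (reduced_matrix d :: ('k mon, nat \<times> 'k mon) lmatrix))))})"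

end

theory Submission
  imports Defs
begin

text \<open>
  The bounds follow once the rank of the hit matrix is understood in three ways.

  First, the column space of the hit matrix is the whole space of hit polynomials of degree \<open>d\<close>
  (\<open>hits_homog\<close>), so the dimension of the cohits is the number of monomials minus the rank
  (\<open>dim_cohits\<close>). This rests on two facts about the squares. They satisfy the Adem relations on
  polynomials (\<open>Sq_adem\<close>), so the action of a class in the Steenrod algebra is that of any of its
  representatives (\<open>act_abs\<close>) and is multiplicative. And by the Adem relations every positive square
  is a sum of composites of squares \<open>Sq\<^bsup>2^t\<^esup>\<close> (\<open>Sq_hit_space\<close>). The Adem relations themselves are
  proved by adding one variable at a time: for \<open>x\<close> of degree one, \<open>Sq\<^sup>n(x f) = x Sq\<^sup>n f + x\<^sup>2 Sq\<^sup>n\<^sup>-\<^sup>1 f\<close>,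
  and the relation for \<open>x f\<close> splits into instances of the relations for \<open>f\<close> by Pascal's rule.

  Second, the columns of the first square can be split off exactly. The map \<open>h\<close> is a contracting
  homotopy, \<open>Sq\<^sup>1 h + h Sq\<^sup>1 = 1\<close> in positive degrees, so \<open>p = h Sq\<^sup>1\<close> has the image of \<open>Sq\<^sup>1\<close> as its
  kernel. Applying \<open>p\<close> to the column space gives
  \<open>rank M = \<rho> + rank M'\<close> with \<open>M'\<close> the reduced matrix (\<open>mat_rank_hit_reduced\<close>). Hence every bound
  for the rank of \<open>M'\<close> becomes one for the rank of \<open>M\<close>.

  Third, the rank is bounded from both sides. From below: columns with acyclic pivots are linearly
  independent, since a pivot row without outgoing arrows to the other pivots occurs in just one of the
  columns (\<open>acyclic_pivots_card_le_rank\<close>); and leading rows for a total order are acyclic pivots, as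
  all arrows increase (\<open>lead_count_le_tau\<close>). From above: functionals in the dual kernel vanish on the
  column space (\<open>dim_dual_kernel\<close>); the kernel of the hit map contains the trivial columns, the
  image of \<open>Sq\<^sup>1\<close> in the summand of \<open>t = 0\<close>, and the images of all relations
  (\<open>mat_rank_le_W1_delta1\<close>); and a rank never exceeds the number of nonzero rows or columns.

  All spaces that occur are finite, so dimensions are obtained by counting: a space of dimension \<open>n\<close>
  over the field with two elements has \<open>2\<^sup>n\<close> elements.
\<close>

section \<open>Linear algebra over the field with two elements\<close>

lemma f2_subspaceI:
  assumes "0 \<in> V" "\<And>x y. x \<in> V \<Longrightarrow> y \<in> V \<Longrightarrow> x + y \<in> V"
  shows "F2.subspace V"
  using assms by (auto intro!: F2.subspaceI simp: bscale_def)

lemma f2_add_eq_0_iff: "x + y = 0 \<longleftrightarrow> x = (y :: 'a::f2_space)"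
  by (metis add_eq_0_iff f2_uminus)

text \<open>Over the field with two elements additivity alone implies linearity, so linear maps are
  represented by the predicate \<open>additive\<close> below.\<close>

lemma additive_module_hom:
  fixes f :: "'a::f2_space \<Rightarrow> 'b::f2_space"
  assumes "additive f"
  shows "module_hom bscale bscale f"
proof -
  interpret additive f by fact
  show ?thesis
    unfolding module_hom_iff
    by (auto simp: F2.module_axioms add zero bscale_def)
qed

lemmas additive_span_image = module_hom.span_image [OF additive_module_hom, symmetric]
lemmas additive_subspace_image = module_hom.subspace_image [OF additive_module_hom]

lemma f2_span_subset_sums:
  assumes "finite B"
  shows "F2.span B = (\<lambda>S. \<Sum>S) ` Pow B"
proof (intro equalityI subsetI)
  fix x assume "x \<in> F2.span B"
  then obtain u where u: "x = (\<Sum>v\<in>B. bscale (u v) v)"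
    using F2.span_finite [OF assms] by auto
  have "x = \<Sum>{v\<in>B. u v = 1}"
    unfolding u using assms by (simp add: bscale_def sum.inter_filter)
  then show "x \<in> (\<lambda>S. \<Sum>S) ` Pow B" by blast
next
  fix x assume "x \<in> (\<lambda>S. \<Sum>S) ` Pow B"
  then show "x \<in> F2.span B" by (auto intro: F2.span_sum F2.span_base)
qed

lemma f2_finite_span: "finite B \<Longrightarrow> finite (F2.span B)"
  by (simp add: f2_span_subset_sums)

text \<open>A linear dependence over the field with two elements is a nonempty finite subset whose
  sum is zero, so the subset sums of a basis are pairwise distinct. Hence dimensions of finite
  spaces can be computed by counting elements, and no finite-dimensional ambient space is needed.\<close>

lemma f2_independent_sum_inj:
  assumes "finite B" "\<not> F2.dependent B"
  shows "inj_on (\<lambda>S. \<Sum>S) (Pow B)"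
proof (rule inj_onI)
  fix S T assume ST: "S \<in> Pow B" "T \<in> Pow B" and eq: "\<Sum>S = \<Sum>T"
  define u where "u v = (of_bool (v \<in> S) + of_bool (v \<in> T) :: bit)" for v
  have "(\<Sum>v\<in>B. bscale (u v) v)
      = (\<Sum>v\<in>B. bscale (of_bool (v \<in> S)) v) + (\<Sum>v\<in>B. bscale (of_bool (v \<in> T)) v)"
    unfolding u_def F2.scale_left_distrib sum.distrib ..
  also have "(\<Sum>v\<in>B. bscale (of_bool (v \<in> S)) v) = (\<Sum>v\<in>B. if v \<in> S then v else 0)"
    by (intro sum.cong refl) (simp add: bscale_def)
  also have "\<dots> = \<Sum>S"
    using ST assms(1) by (simp add: sum.If_cases Int_absorb1 Int_commute)
  also have "(\<Sum>v\<in>B. bscale (of_bool (v \<in> T)) v) = (\<Sum>v\<in>B. if v \<in> T then v else 0)"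
    by (intro sum.cong refl) (simp add: bscale_def)
  also have "\<dots> = \<Sum>T"
    using ST assms(1) by (simp add: sum.If_cases Int_absorb1 Int_commute)
  finally have "(\<Sum>v\<in>B. bscale (u v) v) = 0" using eq by simp
  then have "u v = 0" if "v \<in> B" for v
    using F2.independentD [OF assms(2) assms(1) subset_refl] that by blast
  then have "v \<in> S \<longleftrightarrow> v \<in> T" if "v \<in> B" for v
    using that by (fastforce simp: u_def of_bool_def split: if_splits)
  then show "S = T" using ST by auto
qed

lemma f2_card_subspace:
  assumes "finite V" "F2.subspace V"
  shows "card V = 2 ^ F2.dim V"
proof -
  obtain B where B: "B \<subseteq> V" "\<not> F2.dependent B" "V \<subseteq> F2.span B" "card B = F2.dim V"
    using F2.basis_exists by blast
  then have V: "V = F2.span B"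
    using F2.span_minimal assms(2) by blast
  have fB: "finite B" using B(1) assms(1) finite_subset by blast
  have "card V = card (Pow B)"
    unfolding V f2_span_subset_sums [OF fB]
    by (rule card_image [OF f2_independent_sum_inj [OF fB B(2)]])
  then show ?thesis using fB B(4) by (simp add: card_Pow)
qed

lemma f2_dim_leI:
  assumes "finite V" "F2.subspace V" "card V \<le> 2 ^ n"
  shows "F2.dim V \<le> n"
  using assms f2_card_subspace [OF assms(1,2)] by simp

lemma f2_dim_mono:
  assumes "finite W" "F2.subspace V" "F2.subspace W" "V \<subseteq> W"
  shows "F2.dim V \<le> F2.dim W"
  using assms by (intro f2_dim_leI) (auto simp: f2_card_subspace [symmetric] intro: card_mono finite_subset)

text \<open>The fibres of \<open>f\<close> over its image are translates of the kernel, so the number of elements of \<open>V\<close>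
  is the product of those of the kernel and of the image.\<close>

lemma f2_rank_nullity:
  fixes f :: "'a::f2_space \<Rightarrow> 'b::f2_space"
  assumes f: "additive f" and V: "finite V" "F2.subspace V"
  shows "F2.dim V = F2.dim {x\<in>V. f x = 0} + F2.dim (f ` V)"
proof -
  interpret additive f by fact
  let ?K = "{x\<in>V. f x = 0}"
  have K: "F2.subspace ?K"
    using V(2) by (auto intro!: f2_subspaceI simp: add zero F2.subspace_add F2.subspace_0)
  have fib: "card {x\<in>V. f x = y} = card ?K" if y: "y \<in> f ` V" for y
  proof -
    obtain v where v: "v \<in> V" "y = f v" using y by blast
    have "{x\<in>V. f x = y} = (\<lambda>x. x + v) ` ?K"
    proof (intro equalityI subsetI)
      fix x assume "x \<in> {x\<in>V. f x = y}"
      then have "x + v \<in> ?K" using v V(2) by (auto simp: add F2.subspace_add)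
      moreover have "x = (x + v) + v" by (simp add: add.assoc)
      ultimately show "x \<in> (\<lambda>x. x + v) ` ?K" by blast
    qed (use v V(2) in \<open>auto simp: add F2.subspace_add\<close>)
    moreover have "inj_on (\<lambda>x. x + v) ?K" by (simp add: inj_on_def)
    ultimately show ?thesis by (simp add: card_image)
  qed
  have "card V = card (\<Union>y\<in>f ` V. {x\<in>V. f x = y})" by (rule arg_cong [of _ _ card]) auto
  also have "\<dots> = (\<Sum>y\<in>f ` V. card {x\<in>V. f x = y})"
    using V(1) by (intro card_UN_disjoint) auto
  also have "\<dots> = card (f ` V) * card ?K" using fib by simp
  finally have "2 ^ F2.dim V = (2::nat) ^ (F2.dim ?K + F2.dim (f ` V))"
    using V K additive_subspace_image [OF f V(2)]
    by (simp add: f2_card_subspace power_add)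
  then show ?thesis by simp
qed

text \<open>Used to bound the dimension of a space from its generators modulo a subspace.\<close>

lemma f2_dim_span_Un_le:
  assumes "finite A" "finite S" "V \<subseteq> F2.span (A \<union> S)" "F2.subspace V"
  shows "F2.dim V \<le> F2.dim (F2.span A) + card S"
proof -
  obtain B where B: "B \<subseteq> A" "\<not> F2.dependent B" "A \<subseteq> F2.span B" "card B = F2.dim A"
    using F2.basis_exists by blast
  have fB: "finite B" using B(1) assms(1) finite_subset by blast
  have "A \<union> S \<subseteq> F2.span (B \<union> S)"
    using B(3) F2.span_mono [of B "B \<union> S"] F2.span_superset [of "B \<union> S"] by blast
  then have "V \<subseteq> F2.span (B \<union> S)"
    using assms(3) F2.span_minimal by blast
  then have "F2.dim V \<le> card (B \<union> S)" using fB assms(2) by (intro F2.dim_le_card) auto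
  also have "\<dots> \<le> card B + card S" by (rule card_Un_le)
  finally show ?thesis using B(4) by simp
qed

text \<open>A polynomial over the field with two elements is the set of its monomials.\<close>

lemma f2_pm_keys_eq: "Poly_Mapping.keys f = Poly_Mapping.keys g \<Longrightarrow> f = (g :: 'a \<Rightarrow>\<^sub>0 bit)"
proof (rule poly_mapping_eqI)
  fix k assume "Poly_Mapping.keys f = Poly_Mapping.keys g"
  then have "Poly_Mapping.lookup f k \<noteq> 0 \<longleftrightarrow> Poly_Mapping.lookup g k \<noteq> 0"
    by (metis in_keys_iff)
  then show "Poly_Mapping.lookup f k = Poly_Mapping.lookup g k" by (cases "Poly_Mapping.lookup f k"; cases "Poly_Mapping.lookup g k") auto
qed

lemma f2_keys_subspace: "F2.subspace {f :: 'a \<Rightarrow>\<^sub>0 bit. Poly_Mapping.keys f \<subseteq> S}"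
  by (intro f2_subspaceI) (use Poly_Mapping.keys_add in fastforce)+

lemma f2_keys_card:
  assumes "finite S"
  shows "finite {f :: 'a \<Rightarrow>\<^sub>0 bit. Poly_Mapping.keys f \<subseteq> S}"
    and "F2.dim {f :: 'a \<Rightarrow>\<^sub>0 bit. Poly_Mapping.keys f \<subseteq> S} = card S"
proof -
  let ?V = "{f :: 'a \<Rightarrow>\<^sub>0 bit. Poly_Mapping.keys f \<subseteq> S}"
  have inj: "inj_on Poly_Mapping.keys ?V" by (simp add: inj_on_def f2_pm_keys_eq)
  have im: "Poly_Mapping.keys ` ?V = Pow S"
  proof (intro equalityI subsetI)
    fix T assume T: "T \<in> Pow S"
    then have fT: "finite T" using assms finite_subset by blast
    have "Poly_Mapping.lookup (\<Sum>t\<in>T. Poly_Mapping.single t (1::bit)) k = of_bool (k \<in> T)" for k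
      using fT by (simp add: lookup_sum lookup_single when_def)
    then have "Poly_Mapping.keys (\<Sum>t\<in>T. Poly_Mapping.single t (1::bit)) = T"
      by (auto simp: in_keys_iff)
    then show "T \<in> Poly_Mapping.keys ` ?V" using T by (intro image_eqI [OF sym]) auto
  qed auto
  show fin: "finite ?V" using finite_imageD [OF _ inj] im assms by simp
  have "card ?V = 2 ^ card S" using card_image [OF inj] im assms by (simp add: card_Pow)
  then show "F2.dim ?V = card S" using f2_card_subspace [OF fin f2_keys_subspace] by simp
qed

section \<open>Linear extension and monomials\<close>

lemma lin_ext_superset:
  assumes "finite A" "Poly_Mapping.keys f \<subseteq> A"
  shows "lin_ext F f = (\<Sum>e\<in>A. bscale (Poly_Mapping.lookup f e) (F e))"
  unfolding lin_ext_def
  by (rule sum.mono_neutral_left) (use assms in \<open>auto simp: in_keys_iff\<close>)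

lemma additive_lin_ext: "additive (lin_ext F)"
proof
  fix f g :: "'a \<Rightarrow>\<^sub>0 bit"
  let ?A = "Poly_Mapping.keys f \<union> Poly_Mapping.keys g"
  have "lin_ext F (f + g) = (\<Sum>e\<in>?A. bscale (Poly_Mapping.lookup (f + g) e) (F e))"
    by (rule lin_ext_superset) (use Poly_Mapping.keys_add [of f g] in auto)
  also have "\<dots> = (\<Sum>e\<in>?A. bscale (Poly_Mapping.lookup f e) (F e)) + (\<Sum>e\<in>?A. bscale (Poly_Mapping.lookup g e) (F e))"
    unfolding lookup_add F2.scale_left_distrib sum.distrib ..
  also have "\<dots> = lin_ext F f + lin_ext F g"
    by (simp add: lin_ext_superset [of ?A])
  finally show "lin_ext F (f + g) = lin_ext F f + lin_ext F g" .
qed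

lemma lin_ext_single [simp]: "lin_ext F (Poly_Mapping.single a 1) = F a"
  by (simp add: lin_ext_def bscale_def)

lemma f2_pm_expand: "(f :: 'a \<Rightarrow>\<^sub>0 bit) = (\<Sum>e\<in>Poly_Mapping.keys f. Poly_Mapping.single e 1)"
proof (rule poly_mapping_eqI)
  fix k
  have "Poly_Mapping.lookup (\<Sum>e\<in>Poly_Mapping.keys f. Poly_Mapping.single e 1) k = of_bool (k \<in> Poly_Mapping.keys f)"
    by (simp add: lookup_sum lookup_single when_def)
  then show "Poly_Mapping.lookup f k = Poly_Mapping.lookup (\<Sum>e\<in>Poly_Mapping.keys f. Poly_Mapping.single e 1) k"
    by (cases "Poly_Mapping.lookup f k") (auto simp: in_keys_iff)
qed

lemma f2_pm_induct [case_names zero add]: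
  assumes "P 0" "\<And>a f. P f \<Longrightarrow> a \<notin> Poly_Mapping.keys f \<Longrightarrow> P (Poly_Mapping.single a 1 + f)"
  shows "P (f :: 'a \<Rightarrow>\<^sub>0 bit)"
proof -
  have "P (\<Sum>e\<in>A. Poly_Mapping.single e 1)" if "finite A" for A
    using that
  proof induction
    case (insert a A)
    have "a \<notin> Poly_Mapping.keys (\<Sum>e\<in>A. Poly_Mapping.single e (1::bit))"
      using insert by (auto simp: in_keys_iff lookup_sum lookup_single when_def)
    then show ?case using insert assms(2) by simp
  qed (simp add: assms)
  then show ?thesis using f2_pm_expand [of f] by (metis finite_keys)
qed

text \<open>The principle by which identities between operations on polynomials, and on the free algebra,
  are reduced to basis elements.\<close>

lemma additive_eqI:
  fixes S T :: "('a \<Rightarrow>\<^sub>0 bit) \<Rightarrow> 'b::f2_space"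
  assumes "additive S" "additive T" "\<And>a. S (Poly_Mapping.single a 1) = T (Poly_Mapping.single a 1)"
  shows "S f = T f"
  by (induction f rule: f2_pm_induct)
    (simp_all add: additive.zero [OF assms(1)] additive.zero [OF assms(2)]
       additive.add [OF assms(1)] additive.add [OF assms(2)] assms(3))

lemma additive_comp: "additive f \<Longrightarrow> additive g \<Longrightarrow> additive (\<lambda>x. f (g x))"
  by (simp add: additive_def)

lemma additive_plus:
  fixes f g :: "'a::ab_group_add \<Rightarrow> 'b::ab_group_add"
  shows "additive f \<Longrightarrow> additive g \<Longrightarrow> additive (\<lambda>x. f x + g x)"
  by (simp add: additive_def algebra_simps)

lemma additive_sum_fun:
  fixes f :: "'i \<Rightarrow> 'a::ab_group_add \<Rightarrow> 'b::ab_group_add"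
  shows "(\<And>i. additive (f i)) \<Longrightarrow> additive (\<lambda>x. \<Sum>i\<in>I. f i x)"
  by (simp add: additive_def sum.distrib)

lemma additive_bscale: "additive f \<Longrightarrow> additive (\<lambda>x. bscale c (f x))"
  by (simp add: additive_def F2.scale_right_distrib)

section \<open>Steenrod squares on polynomials\<close>

lemma lin_ext_in_subspace:
  assumes "F2.subspace V" "\<And>e. e \<in> Poly_Mapping.keys f \<Longrightarrow> F e \<in> V"
  shows "lin_ext F f \<in> V"
  unfolding lin_ext_def by (intro F2.subspace_sum F2.subspace_scale assms)

lemma homog_keys: "homog n = {f. Poly_Mapping.keys f \<subseteq> {e. mdeg e = n}}"
  by (auto simp: homog_def)

lemma homog_subspace: "F2.subspace (homog n)"
  unfolding homog_keys by (rule f2_keys_subspace)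

lemma homog_finite: "finite (homog n :: 'k::finite mpol set)"
  unfolding homog_keys by (intro f2_keys_card finite_mdeg)

lemma dim_homog: "F2.dim (homog n :: 'k::finite mpol set) = card {e :: 'k mon. mdeg e = n}"
  unfolding homog_keys by (intro f2_keys_card finite_mdeg)

lemma xpow_homog_iff [simp]: "xpow e \<in> homog n \<longleftrightarrow> mdeg e = n"
  by (simp add: homog_def xpow_def)

lemma single_homog: "mdeg e = n \<Longrightarrow> Poly_Mapping.single e c \<in> homog n"
  by (simp add: homog_def)

lemma mdeg_zero [simp]: "mdeg 0 = 0"
  and mdeg_add [simp]: "mdeg (a + b) = mdeg a + mdeg b"
  and mdeg_single [simp]: "mdeg (Poly_Mapping.single i n) = n"
  by (simp_all add: mdeg_def lookup_add sum.distrib lookup_single when_def)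

lemma mdeg_eq_0_iff [simp]: "mdeg e = 0 \<longleftrightarrow> e = 0"
  by (auto simp: mdeg_def intro: poly_mapping_eqI)

lemma additive_Sq: "additive (Sq r)"
  unfolding Sq_def by (rule additive_lin_ext)

lemmas Sq_add = additive.add [OF additive_Sq]
lemmas Sq_zero [simp] = additive.zero [OF additive_Sq]

lemma Sq_xpow: "Sq r (xpow a) = (\<Sum>b | mdeg b = r.
     Poly_Mapping.single (a + b) (of_nat (\<Prod>i\<in>UNIV. expo a i choose expo b i)))"
  by (simp add: Sq_def xpow_def)

lemma Sq_homog: "f \<in> homog n \<Longrightarrow> Sq r f \<in> homog (n + r)"
  unfolding Sq_def
  by (intro lin_ext_in_subspace homog_subspace F2.subspace_sum single_homog) (auto simp: homog_def)

lemma additive_id: "additive (\<lambda>f :: 'a::ab_group_add. f)"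
  by (simp add: additive_def)

lemma Sq_0 [simp]: "Sq 0 f = f"
  by (rule additive_eqI [OF additive_Sq additive_id]) (use Sq_xpow [of 0] in \<open>simp add: xpow_def\<close>)

lemma Sq_one: "r > 0 \<Longrightarrow> Sq r (xpow 0) = 0"
proof -
  assume "r > 0"
  have "Poly_Mapping.single (0 + b) (of_nat (\<Prod>i\<in>UNIV. expo 0 i choose expo b i)) = (0 :: 'a mpol)"
    if b: "mdeg b = r" for b :: "'a mon"
  proof -
    obtain i where "expo b i \<noteq> 0"
      using b \<open>r > 0\<close> by (metis mdeg_eq_0_iff less_numeral_extra(3) lookup_zero poly_mapping_eqI)
    then have "(\<Prod>i\<in>UNIV. expo 0 i choose expo b i) = 0"
      by (intro prod_zero bexI [of _ i]) auto
    then show ?thesis by (metis of_nat_0 single_zero)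
  qed
  then show ?thesis by (simp add: Sq_xpow del: of_nat_prod)
qed

abbreviation var :: "'k \<Rightarrow> 'k mpol" where
  "var i \<equiv> xpow (Poly_Mapping.single i 1)"

lemma xpow_mult: "xpow a * xpow b = xpow (a + b)"
  by (simp add: xpow_def mult_single)

lemma var_mult_single: "var i * Poly_Mapping.single a c = Poly_Mapping.single (Poly_Mapping.single i 1 + a) c"
  by (simp add: xpow_def mult_single)

definition sq_coeff :: "'k::finite mon \<Rightarrow> 'k mon \<Rightarrow> bit" where
  "sq_coeff a b = of_nat (\<Prod>i\<in>UNIV. expo a i choose expo b i)"

text \<open>Pascal's rule in the factor at \<open>i\<close>; the other factors of the two coefficients agree.\<close>

lemma sq_coeff_Suc:
  "sq_coeff (Poly_Mapping.single i 1 + a) b =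
     sq_coeff a b + (if expo b i = 0 then 0 else sq_coeff a (b - Poly_Mapping.single i 1))"
proof -
  let ?P = "\<Prod>j\<in>UNIV - {i}. expo a j choose expo b j"
  have split: "(\<Prod>j\<in>UNIV. f j) = f i * (\<Prod>j\<in>UNIV - {i}. f j)" for f :: "'a \<Rightarrow> nat"
    by (rule prod.remove) simp_all
  have 1: "(\<Prod>j\<in>UNIV. expo (Poly_Mapping.single i 1 + a) j choose expo b j) = (Suc (expo a i) choose expo b i) * ?P"
    unfolding split [of "\<lambda>j. expo (Poly_Mapping.single i 1 + a) j choose expo b j"]
    by (intro arg_cong2 [of _ _ _ _ "(*)"] prod.cong) (auto simp: lookup_add lookup_single when_def)
  have 2: "(\<Prod>j\<in>UNIV. expo a j choose expo b j) = (expo a i choose expo b i) * ?P"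
    by (rule split)
  have 3: "(\<Prod>j\<in>UNIV. expo a j choose expo (b - Poly_Mapping.single i 1) j) = (expo a i choose (expo b i - 1)) * ?P"
    unfolding split [of "\<lambda>j. expo a j choose expo (b - Poly_Mapping.single i 1) j"]
    by (intro arg_cong2 [of _ _ _ _ "(*)"] prod.cong) (auto simp: lookup_minus lookup_single when_def)
  show ?thesis
    unfolding sq_coeff_def 1 2 3
    by (cases "expo b i") (simp_all only: binomial_n_0 binomial_Suc_Suc nat.simps refl if_True if_False
        diff_Suc_1 distrib_right of_nat_add add_0_left add_0_right add.commute)
qed

text \<open>The Cartan formula for multiplication by a variable, on which the total square acts by
  \<open>x \<mapsto> x + x\<^sup>2\<close>.\<close>

lemma Sq_var_mult:
  "Sq (Suc r) (var i * f) = var i * Sq (Suc r) f + var i * var i * Sq r f"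
proof (rule additive_eqI [where S = "\<lambda>f. Sq (Suc r) (var i * f)"
      and T = "\<lambda>f. var i * Sq (Suc r) f + var i * var i * Sq r f"])
  fix a :: "'a mon"
  let ?e = "Poly_Mapping.single i (1::nat)"
  have fin: "finite {b :: 'a mon. mdeg b = n}" for n by (rule finite_mdeg)
  have "Sq (Suc r) (var i * xpow a) = (\<Sum>b | mdeg b = Suc r. Poly_Mapping.single (?e + a + b) (sq_coeff (?e + a) b))"
    by (simp add: xpow_mult Sq_xpow sq_coeff_def)
  also have "\<dots> = (\<Sum>b | mdeg b = Suc r. Poly_Mapping.single (?e + a + b) (sq_coeff a b))
      + (\<Sum>b | mdeg b = Suc r. Poly_Mapping.single (?e + a + b) (if expo b i = 0 then 0 else sq_coeff a (b - ?e)))"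
    unfolding sq_coeff_Suc single_add sum.distrib ..
  also have "(\<Sum>b | mdeg b = Suc r. Poly_Mapping.single (?e + a + b) (sq_coeff a b)) = var i * Sq (Suc r) (xpow a)"
    unfolding Sq_xpow sum_distrib_left sq_coeff_def var_mult_single add.assoc ..
  also have "(\<Sum>b | mdeg b = Suc r. Poly_Mapping.single (?e + a + b) (if expo b i = 0 then 0 else sq_coeff a (b - ?e)))
     = (\<Sum>b | mdeg b = Suc r \<and> expo b i \<noteq> 0. Poly_Mapping.single (?e + a + b) (sq_coeff a (b - ?e)))"
    by (rule sum.mono_neutral_cong_right) (auto simp: fin)
  \<comment> \<open>The second summand of Pascal's rule lives on the \<open>b\<close> divisible by the variable; divide it out.\<close>
  also have "\<dots> = (\<Sum>b | mdeg b = r. Poly_Mapping.single (?e + a + (?e + b)) (sq_coeff a b))"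
  proof (rule sum.reindex_bij_witness [of _ "\<lambda>b. ?e + b" "\<lambda>b. b - ?e"])
    fix b assume b: "b \<in> {b. mdeg b = Suc r \<and> expo b i \<noteq> 0}"
    show *: "?e + (b - ?e) = b"
      by (rule poly_mapping_eqI) (use b in \<open>auto simp: lookup_add lookup_minus lookup_single when_def\<close>)
    have "mdeg (?e + (b - ?e)) = Suc r" using b unfolding * by simp
    then show "b - ?e \<in> {b. mdeg b = r}" by simp
    show "Poly_Mapping.single (?e + a + (?e + (b - ?e))) (sq_coeff a (b - ?e)) =
         Poly_Mapping.single (?e + a + b) (sq_coeff a (b - ?e))" unfolding * ..
  qed (auto simp: lookup_add)
  also have "\<dots> = var i * var i * Sq r (xpow a)"
    unfolding Sq_xpow sum_distrib_left sq_coeff_def mult.assoc var_mult_single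
    by (simp only: add_ac)
  finally show "Sq (Suc r) (var i * Poly_Mapping.single a 1) =
       var i * Sq (Suc r) (Poly_Mapping.single a 1) + var i * var i * Sq r (Poly_Mapping.single a 1)"
    by (simp only: xpow_def)
qed (simp_all add: additive_def Sq_add distrib_left algebra_simps)

lemma mon_cases [case_names one var]:
  fixes e :: "'k mon"
  obtains "e = 0" | i e' where "e = Poly_Mapping.single i 1 + e'"
proof (cases "e = 0")
  case False
  then obtain i where i: "expo e i \<noteq> 0"
    by (metis lookup_zero poly_mapping_eqI)
  have "e = Poly_Mapping.single i 1 + (e - Poly_Mapping.single i 1)"
    by (rule poly_mapping_eqI) (use i in \<open>auto simp: lookup_add lookup_minus lookup_single when_def\<close>)
  then show ?thesis using that by blast
qed

lemma mon_induct [case_names one var]: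
  fixes e :: "'k::finite mon"
  assumes "P 0" "\<And>i e. P e \<Longrightarrow> P (Poly_Mapping.single i 1 + e)"
  shows "P e"
proof (induction "mdeg e" arbitrary: e)
  case 0
  then show ?case using assms(1) by simp
next
  case (Suc n)
  show ?case
  proof (cases e rule: mon_cases)
    case (var i e')
    then show ?thesis using Suc assms(2) by simp
  qed (use assms(1) in simp)
qed

section \<open>The Adem relations\<close>

text \<open>Squares with integer index, zero in negative degrees. In the induction below the indices of the
  Adem relations are lowered by one and two, which is uniform only without truncated subtraction.\<close>

definition Sqz :: "int \<Rightarrow> 'k::finite mpol \<Rightarrow> 'k mpol" where
  "Sqz n f = (if n < 0 then 0 else Sq (nat n) f)"

text \<open>The binomial coefficient modulo two, extended to negative \<open>n\<close>. Only \<open>n = -1\<close> matters: there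
  \<open>(-1) choose m = (-1)\<^sup>m\<close> is one modulo two for all \<open>m \<ge> 0\<close>, and Pascal's rule for \<open>n = 0\<close> holds.\<close>

definition binz :: "int \<Rightarrow> int \<Rightarrow> bit" where
  "binz n m = (if m < 0 then 0 else if n < 0 then 1 else of_nat (nat n choose nat m))"

lemma binz_pascal:
  assumes "n \<ge> 0"
  shows "binz n m = binz (n - 1) m + binz (n - 1) (m - 1)"
proof -
  obtain k where k: "n = int k" using assms nonneg_int_cases by blast
  consider "m < 0" | "m = 0" | l where "m = int (Suc l)"
    by (metis nonneg_int_cases not_less old.nat.exhaust of_nat_0)
  then show ?thesis
  proof cases
    case (3 l)
    show ?thesis
    proof (cases k)
      case 0
      then show ?thesis using 3 k by (simp add: binz_def nat_add_distrib)
    next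
      case (Suc n')
      then have "binz n m = of_nat (Suc n' choose Suc l)" "binz (n - 1) m = of_nat (n' choose Suc l)"
        "binz (n - 1) (m - 1) = of_nat (n' choose l)"
        using 3 k by (simp_all add: binz_def nat_add_distrib del: binomial_Suc_Suc)
      then show ?thesis by (simp only: binomial_Suc_Suc of_nat_add add.commute)
    qed
  qed (auto simp: binz_def)
qed

lemma additive_Sqz: "additive (Sqz n)"
  by (auto simp: Sqz_def additive_def Sq_add)

lemmas Sqz_add = additive.add [OF additive_Sqz]

lemma Sqz_var_mult: "Sqz n (var i * f) = var i * Sqz n f + var i * var i * Sqz (n - 1) f"
proof -
  consider "n < 0" | "n = 0" | r where "n = int (Suc r)"
    by (metis nonneg_int_cases not_less old.nat.exhaust of_nat_0)
  then show ?thesis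
  proof cases
    case (3 r)
    then have "nat n = Suc r" "nat (n - 1) = r" by simp_all
    then show ?thesis using 3 by (simp add: Sqz_def Sq_var_mult del: One_nat_def)
  qed (auto simp: Sqz_def)
qed

text \<open>The square of a variable has degree two and total square \<open>x\<^sup>2 + x\<^sup>4\<close>: the two mixed terms cancel.\<close>

lemma Sqz_var_var_mult:
  "Sqz n (var i * var i * f) = var i * var i * Sqz n f + var i * var i * var i * var i * Sqz (n - 2) f"
proof -
  let ?x = "var i" and ?c = "var i * var i * var i * Sqz (n - 1) f"
  have "Sqz n (?x * (?x * f)) = ?x * (?x * Sqz n f + ?x * ?x * Sqz (n - 1) f)
      + ?x * ?x * (?x * Sqz (n - 1) f + ?x * ?x * Sqz (n - 1 - 1) f)"
    by (simp only: Sqz_var_mult [of _ _ "?x * f"] Sqz_var_mult [of _ _ f])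
  also have "\<dots> = ?x * ?x * Sqz n f + (?c + ?c) + ?x * ?x * ?x * ?x * Sqz (n - 2) f"
    by (simp only: distrib_left mult.assoc add.assoc diff_diff_eq one_add_one)
  finally show ?thesis by (simp only: add_self add_0_right mult.assoc)
qed

text \<open>The right-hand side of the Adem relation. The bound \<open>N\<close> is kept fixed while \<open>a\<close> and \<open>b\<close> vary; the
  coefficients with \<open>2 j > a\<close> are zero, so any \<open>N \<ge> a\<close> gives the same value.\<close>

definition adem_sum :: "nat \<Rightarrow> int \<Rightarrow> int \<Rightarrow> 'k::finite mpol \<Rightarrow> 'k mpol" where
  "adem_sum N a b f = (\<Sum>j\<le>N. bscale (binz (b - 1 - int j) (a - 2 * int j)) (Sqz (a + b - int j) (Sqz (int j) f)))"

lemma additive_adem_sum: "additive (adem_sum N a b)"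
  unfolding adem_sum_def
  by (intro additive_sum_fun additive_bscale additive_comp [OF additive_Sqz additive_Sqz])

lemma bscale_mult_right: "bscale c (g * f) = g * bscale c (f :: 'k mpol)"
  by (simp add: bscale_def)

lemma sum_shift_down:
  fixes w :: "nat \<Rightarrow> 'a::comm_monoid_add"
  assumes "w 0 = 0" "w (Suc N) = 0"
  shows "(\<Sum>j\<le>N. w j) = (\<Sum>j\<le>N. w (Suc j))"
  using sum.atMost_Suc_shift [of w N] sum.atMost_Suc [of w N] assms by simp

text \<open>The coefficient identity behind the terms with \<open>x\<^sup>2\<close>: after Pascal's rule on both sides the same three
  coefficients remain.\<close>

lemma binz_exchange:
  assumes "a < 2 * b"
  shows "binz (b - 1 - j) (a - 2 * j) + binz (b - 2 - j) (a - 2 * j - 2)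
       = binz (b - 1 - j) (a - 2 * j - 1) + binz (b - 2 - j) (a - 2 * j)"
proof (cases "a - 2 * j < 0")
  case True
  then show ?thesis by (simp add: binz_def)
next
  case False
  then have n: "b - 1 - j \<ge> 0" using assms by linarith
  have e: "b - 1 - j - 1 = b - 2 - j" "a - 2 * j - 1 - 1 = a - 2 * j - 2" by simp_all
  show ?thesis
    using binz_pascal [OF n, of "a - 2 * j"] binz_pascal [OF n, of "a - 2 * j - 1"]
    by (simp only: e) (simp only: add_ac)
qed

text \<open>The terms with \<open>x\<close> and \<open>x\<^sup>4\<close> are single Adem sums for \<open>f\<close>, the latter after an index shift, and those
  with \<open>x\<^sup>2\<close> combine to two of them. The left-hand side \<open>Sq\<^sup>a Sq\<^sup>b\<close> expands in exactly the same way, which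
  makes the induction over the variables of a monomial possible.\<close>

lemma adem_sum_var_mult:
  assumes ab: "a < 2 * b" and N: "nat a \<le> N"
  shows "adem_sum N a b (var i * f) = var i * adem_sum N a b f
     + var i * var i * (adem_sum N (a - 1) b f + adem_sum N a (b - 1) f)
     + var i * var i * var i * var i * adem_sum N (a - 2) (b - 1) f"
proof -
  let ?x = "var i"
  define \<beta> where "\<beta> j = binz (b - 1 - int j) (a - 2 * int j)" for j
  define \<gamma> where "\<gamma> j = binz (b - 2 - int j) (a - 2 * int j - 2)" for j
  define u where "u j = Sqz (a + b - 1 - j) (Sqz j f)" for j
  define v where "v j = Sqz (a + b - 3 - j) (Sqz j f)" for j
  have \<beta>_Suc: "\<beta> (Suc j) = \<gamma> j" for j by (simp add: \<beta>_def \<gamma>_def algebra_simps)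
  have \<beta>_N: "\<beta> (Suc N) = 0" using N by (simp add: \<beta>_def binz_def)
  have neg: "u (-1) = 0" "v (-1) = 0"
    using additive.zero [OF additive_Sqz] by (simp_all add: u_def v_def Sqz_def [of "-1"])
  have shift: "(\<Sum>j\<le>N. bscale (\<beta> j) (w (int j - 1))) = (\<Sum>j\<le>N. bscale (\<gamma> j) (w (int j)))"
    if "w (-1) = 0" for w :: "int \<Rightarrow> 'a mpol"
  proof -
    have "(\<Sum>j\<le>N. bscale (\<beta> j) (w (int j - 1))) = (\<Sum>j\<le>N. bscale (\<beta> (Suc j)) (w (int (Suc j) - 1)))"
      by (rule sum_shift_down) (simp_all add: that \<beta>_N)
    then show ?thesis by (simp add: \<beta>_Suc)
  qed
  have summand: "Sqz (a + b - int j) (Sqz (int j) (?x * f)) = ?x * Sqz (a + b - int j) (Sqz (int j) f)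
      + ?x * ?x * u (int j) + ?x * ?x * u (int j - 1) + ?x * ?x * ?x * ?x * v (int j - 1)" for j
    by (simp only: Sqz_var_mult [of "int j"] Sqz_add Sqz_var_mult Sqz_var_var_mult u_def v_def)
      (simp add: algebra_simps)
  have "adem_sum N a b (?x * f) = ?x * adem_sum N a b f
      + ?x * ?x * ((\<Sum>j\<le>N. bscale (\<beta> j) (u (int j))) + (\<Sum>j\<le>N. bscale (\<beta> j) (u (int j - 1))))
      + ?x * ?x * ?x * ?x * (\<Sum>j\<le>N. bscale (\<beta> j) (v (int j - 1)))"
    unfolding adem_sum_def summand F2.scale_right_distrib sum.distrib bscale_mult_right
      sum_distrib_left [symmetric] \<beta>_def [symmetric]
    by (simp add: algebra_simps)
  also have "(\<Sum>j\<le>N. bscale (\<beta> j) (u (int j))) + (\<Sum>j\<le>N. bscale (\<beta> j) (u (int j - 1)))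
      = (\<Sum>j\<le>N. bscale (\<beta> j + \<gamma> j) (u (int j)))"
    by (simp only: shift neg F2.scale_left_distrib sum.distrib)
  also have "\<dots> = (\<Sum>j\<le>N. bscale (binz (b - 1 - int j) (a - 2 * int j - 1) + binz (b - 2 - int j) (a - 2 * int j)) (u (int j)))"
    unfolding \<beta>_def \<gamma>_def binz_exchange [OF ab] ..
  also have "\<dots> = adem_sum N (a - 1) b f + adem_sum N a (b - 1) f"
    unfolding adem_sum_def F2.scale_left_distrib sum.distrib u_def
    by (intro arg_cong2 [of _ _ _ _ "(+)"] sum.cong refl) (simp_all add: algebra_simps)
  also have "(\<Sum>j\<le>N. bscale (\<beta> j) (v (int j - 1))) = adem_sum N (a - 2) (b - 1) f"
    unfolding shift [of v, OF neg(2)] unfolding adem_sum_def \<gamma>_def v_def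
    by (intro sum.cong refl) (simp add: algebra_simps)
  finally show ?thesis .
qed

text \<open>The expansion for \<open>a < 2 b\<close> refers to the pair \<open>(a, b - 1)\<close>, which may satisfy only
  \<open>a \<le> 2 (b - 1) + 1\<close>. With the extended binomial coefficients the relation is a tautology in the two
  new cases: only the summand \<open>j = b\<close> survives, with \<open>n = -1\<close>.\<close>

lemma adem_sum_boundary:
  assumes ab: "a = 2 * b \<or> a = 2 * b + 1" and N: "nat a \<le> N"
  shows "Sqz a (Sqz b f) = adem_sum N a b f"
proof (cases "b < 0")
  case True
  have "adem_sum N a b f = 0"
    unfolding adem_sum_def by (rule sum.neutral) (use True ab in \<open>auto simp: binz_def\<close>)
  then show ?thesis using True ab by (auto simp: Sqz_def)
next
  case False
  then obtain k where k: "b = int k" using nonneg_int_cases not_less by metis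
  have "adem_sum N a b f = (\<Sum>j\<in>{k}. bscale (binz (b - 1 - int j) (a - 2 * int j)) (Sqz (a + b - int j) (Sqz (int j) f)))"
    unfolding adem_sum_def
  proof (rule sum.mono_neutral_right)
    show "\<forall>j\<in>{..N} - {k}. bscale (binz (b - 1 - int j) (a - 2 * int j)) (Sqz (a + b - int j) (Sqz (int j) f)) = 0"
    proof
      fix j assume j: "j \<in> {..N} - {k}"
      have "binz (b - 1 - int j) (a - 2 * int j) = 0"
      proof (cases "j < k")
        case True
        then have "nat (b - 1 - int j) < nat (a - 2 * int j)" using ab k by auto
        then show ?thesis using True k by (auto simp: binz_def binomial_eq_0)
      next
        case False
        then have "a - 2 * int j < 0" using j ab k by auto
        then show ?thesis by (simp add: binz_def)
      qed
      then show "bscale (binz (b - 1 - int j) (a - 2 * int j)) (Sqz (a + b - int j) (Sqz (int j) f)) = 0"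
        by simp
    qed
  qed (use N ab k in auto)
  also have "\<dots> = Sqz a (Sqz b f)"
    using ab k by (auto simp: binz_def bscale_def)
  finally show ?thesis ..
qed

lemma adem_sum_one:
  assumes "a < 2 * b" "nat a \<le> N"
  shows "Sqz a (Sqz b (xpow 0 :: 'k::finite mpol)) = adem_sum N a b (xpow 0)"
proof -
  have pos: "Sqz n (xpow 0 :: 'k mpol) = 0" if "n \<noteq> 0" for n
    using that by (auto simp: Sqz_def Sq_one)
  have z: "Sqz n (0 :: 'k mpol) = 0" for n by (rule additive.zero [OF additive_Sqz])
  have "bscale (binz (b - 1 - int j) (a - 2 * int j)) (Sqz (a + b - int j) (Sqz (int j) (xpow 0 :: 'k mpol))) = 0" for j
  proof (cases "j = 0")
    case True
    show ?thesis
    proof (cases "a < 0")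
      case False
      then have "a + b \<noteq> 0" using assms by auto
      then show ?thesis using True pos [of "a + b"] by (simp add: Sqz_def [of 0])
    qed (use True in \<open>simp add: binz_def\<close>)
  qed (simp add: pos z)
  then have "adem_sum N a b (xpow 0 :: 'k mpol) = 0" unfolding adem_sum_def by (intro sum.neutral ballI)
  moreover have "Sqz a (Sqz b (xpow 0 :: 'k mpol)) = 0"
    using assms by (cases "b = 0") (auto simp: pos z Sqz_def [of a])
  ultimately show ?thesis by simp
qed

text \<open>Induction over the variables of the monomial. The range \<open>a \<le> 2 b + 1\<close> is closed under the index
  shifts of the expansion.\<close>

lemma adem_xpow:
  assumes "a \<le> 2 * b + 1" "nat a \<le> N"
  shows "Sqz a (Sqz b (xpow e)) = adem_sum N a b (xpow e)"
  using assms
proof (induction e arbitrary: a b rule: mon_induct)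
  case one
  show ?case
  proof (cases "a < 2 * b")
    case False
    then show ?thesis using one by (intro adem_sum_boundary) linarith+
  qed (use one adem_sum_one in blast)
next
  case (var i e)
  show ?case
  proof (cases "a < 2 * b")
    case True
    let ?x = "var i" and ?f = "xpow e"
    have "Sqz a (Sqz b (?x * ?f)) = ?x * Sqz a (Sqz b ?f)
      + ?x * ?x * (Sqz (a - 1) (Sqz b ?f) + Sqz a (Sqz (b - 1) ?f))
      + ?x * ?x * ?x * ?x * Sqz (a - 2) (Sqz (b - 1) ?f)"
      by (simp only: Sqz_var_mult [of b] Sqz_add Sqz_var_mult Sqz_var_var_mult) (simp add: algebra_simps)
    also have "\<dots> = ?x * adem_sum N a b ?f
      + ?x * ?x * (adem_sum N (a - 1) b ?f + adem_sum N a (b - 1) ?f)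
      + ?x * ?x * ?x * ?x * adem_sum N (a - 2) (b - 1) ?f"
      using True var.prems by (simp add: var.IH)
    also have "\<dots> = adem_sum N a b (?x * ?f)"
      by (rule adem_sum_var_mult [OF True var.prems(2), symmetric])
    finally show ?thesis by (simp only: xpow_mult)
  qed (use var.prems in \<open>intro adem_sum_boundary; linarith\<close>)
qed

lemma adem_poly:
  assumes "a \<le> 2 * b + 1" "nat a \<le> N"
  shows "Sqz a (Sqz b f) = adem_sum N a b f"
  by (rule additive_eqI [OF additive_comp [OF additive_Sqz additive_Sqz] additive_adem_sum])
    (use adem_xpow [OF assms] in \<open>simp add: xpow_def\<close>)

lemma Sq_adem:
  assumes "a < 2 * b"
  shows "Sq a (Sq b f) = (\<Sum>j\<le>a div 2. bscale (of_nat ((b - 1 - j) choose (a - 2 * j))) (Sq (a + b - j) (Sq j f)))"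
proof -
  have "Sq a (Sq b f) = Sqz (int a) (Sqz (int b) f)" by (simp add: Sqz_def)
  also have "\<dots> = adem_sum a (int a) (int b) f" using assms by (intro adem_poly) auto
  also have "\<dots> = (\<Sum>j\<le>a div 2. bscale (binz (int b - 1 - int j) (int a - 2 * int j)) (Sqz (int a + int b - int j) (Sqz (int j) f)))"
    unfolding adem_sum_def by (rule sum.mono_neutral_right) (auto simp: binz_def)
  also have "\<dots> = (\<Sum>j\<le>a div 2. bscale (of_nat ((b - 1 - j) choose (a - 2 * j))) (Sq (a + b - j) (Sq j f)))"
  proof (rule sum.cong [OF refl])
    fix j assume "j \<in> {..a div 2}"
    then have j: "2 * j \<le> a" "j < b" using assms by auto
    then have e: "int b - 1 - int j = int (b - 1 - j)" "int a - 2 * int j = int (a - 2 * j)"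
      "int a + int b - int j = int (a + b - j)" by auto
    show "bscale (binz (int b - 1 - int j) (int a - 2 * int j)) (Sqz (int a + int b - int j) (Sqz (int j) f))
        = bscale (of_nat ((b - 1 - j) choose (a - 2 * j))) (Sq (a + b - j) (Sq j f))"
      unfolding e by (simp add: binz_def Sqz_def)
  qed
  finally show ?thesis .
qed

lemma Sq_1_Sq_1 [simp]: "Sq 1 (Sq 1 f) = 0"
  by (subst Sq_adem) simp_all

section \<open>The action of the Steenrod algebra\<close>

lemma additive_foldr_Sq: "additive (foldr Sq w)"
  by (induction w) (simp_all add: additive_def Sq_add)

lemma additive_free_act: "additive (free_act x)"
proof
  fix f g :: "'a mpol"
  show "free_act x (f + g) = free_act x f + free_act x g"
    unfolding free_act_def lin_ext_def
    by (simp add: additive.add [OF additive_foldr_Sq] F2.scale_right_distrib sum.distrib)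
qed

lemma additive_free_act_left: "additive (\<lambda>x. free_act x f)"
  unfolding free_act_def by (rule additive_lin_ext)

lemmas free_act_add_left = additive.add [OF additive_free_act_left]
lemmas free_act_zero_left [simp] = additive.zero [OF additive_free_act_left]
lemmas free_act_zero [simp] = additive.zero [OF additive_free_act]

lemma free_act_single [simp]: "free_act (Poly_Mapping.single w 1) f = foldr Sq w f"
  by (simp add: free_act_def)

lemma free_act_gen_sq [simp]: "free_act (gen_sq r) f = Sq r f"
  by (simp add: gen_sq_def)

text \<open>Both sides are additive in \<open>x\<close> and \<open>y\<close>, and on words the product is concatenation.\<close>

lemma free_act_mult: "free_act (x * y) f = free_act x (free_act y f)"
proof (rule additive_eqI [where S = "\<lambda>x. free_act (x * y) f" and T = "\<lambda>x. free_act x (free_act y f)"])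
  fix u :: "nat list"
  show "free_act (Poly_Mapping.single u 1 * y) f = free_act (Poly_Mapping.single u 1) (free_act y f)"
    by (rule additive_eqI [where S = "\<lambda>y. free_act (Poly_Mapping.single u 1 * y) f"
          and T = "\<lambda>y. free_act (Poly_Mapping.single u 1) (free_act y f)"])
      (simp_all add: additive_def distrib_left free_act_add_left additive.add [OF additive_free_act]
        additive.add [OF additive_foldr_Sq] mult_single plus_list_def)
qed (simp_all add: additive_def distrib_right free_act_add_left)

lemma free_act_one [simp]: "free_act 1 f = f"
proof -
  have "(1 :: free_sq) = Poly_Mapping.single [] 1"
    using single_one [where 'a = "nat list" and 'b = bit] by (simp only: zero_list_def)
  then have "free_act 1 f = free_act (Poly_Mapping.single [] 1) f" by (rule arg_cong)
  also have "\<dots> = foldr Sq [] f" by (rule free_act_single)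
  finally show ?thesis by simp
qed

lemma free_act_of_nat: "free_act (of_nat n) f = bscale (of_nat n) f"
proof (induction n)
  case (Suc n)
  have "free_act (of_nat (Suc n)) f = f + bscale (of_nat n) f"
    by (simp only: of_nat_Suc free_act_add_left free_act_one Suc.IH)
  also have "\<dots> = bscale (of_nat (Suc n)) f"
    unfolding of_nat_Suc F2.scale_left_distrib by (simp add: bscale_def)
  finally show ?case .
qed simp

lemma free_act_minus: "free_act (x - y) f = free_act x f + free_act y f"
  by (simp only: f2_minus free_act_add_left)

lemma free_act_adem:
  assumes "a < 2 * b"
  shows "free_act (adem a b) f = 0"
proof -
  have "free_act (adem a b) f = Sq a (Sq b f) +
     (\<Sum>j\<le>a div 2. bscale (of_nat ((b - 1 - j) choose (a - 2 * j))) (Sq (a + b - j) (Sq j f)))"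
    unfolding adem_def free_act_minus additive.sum [OF additive_free_act_left] free_act_mult
    by (simp add: free_act_of_nat)
  then show ?thesis using Sq_adem [OF assms, of f] by simp
qed

text \<open>The squares on polynomials satisfy the defining relations of the Steenrod algebra, so the
  action of a class does not depend on its representative.\<close>

lemma free_act_ideal:
  assumes "x \<in> steenrod_ideal"
  shows "free_act x f = 0"
  using assms unfolding steenrod_ideal_def
proof (induction rule: F2.span_induct_alt)
  case (step c x z)
  then obtain u r v where x: "x = u * r * v" and r: "r \<in> steenrod_relators" by blast
  have "free_act r g = 0" for g :: "'a mpol"
    using r free_act_adem by (auto simp: steenrod_relators_def free_act_minus)
  then have "free_act x f = 0" by (simp add: x free_act_mult)
  then show ?case using step by (simp add: free_act_add_left bscale_def)
qed simp

lemma act_abs: "act (abs_steenrod x) f = free_act x f"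
proof -
  have "rep_steenrod (abs_steenrod x) - x \<in> steenrod_ideal"
    using Quotient3_rep_abs [OF Quotient3_steenrod, of x] steenrod_ideal_zero by simp
  then have "free_act (rep_steenrod (abs_steenrod x) - x) f = 0" by (rule free_act_ideal)
  then show ?thesis by (simp add: act_def free_act_minus f2_add_eq_0_iff)
qed

lemma steenrod_cases: obtains x where "\<theta> = abs_steenrod x"
  using Quotient3_abs_rep [OF Quotient3_steenrod] by metis

lemma act_add: "act (\<theta> + \<eta>) f = act \<theta> f + act \<eta> f"
  by (rule steenrod_cases [of \<theta>], rule steenrod_cases [of \<eta>])
    (simp add: plus_steenrod.abs_eq act_abs free_act_add_left)

lemma act_mult: "act (\<theta> * \<eta>) f = act \<theta> (act \<eta> f)"
  by (rule steenrod_cases [of \<theta>], rule steenrod_cases [of \<eta>])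
    (simp add: times_steenrod.abs_eq act_abs free_act_mult)

lemma additive_act_left: "additive (\<lambda>\<theta>. act \<theta> f)"
  by (simp add: additive_def act_add)

lemmas act_zero_left [simp] = additive.zero [OF additive_act_left]

lemma act_SqA [simp]: "act (SqA r) f = Sq r f"
  by (simp add: SqA_def act_abs)

lemma foldr_Sq_homog: "f \<in> homog n \<Longrightarrow> foldr Sq w f \<in> homog (n + sum_list w)"
proof (induction w)
  case (Cons r w)
  then show ?case using Sq_homog [of "foldr Sq w f" "n + sum_list w" r] by (simp add: add_ac)
qed simp

lemma act_homog:
  assumes "\<theta> \<in> steenrod_homog m" "f \<in> homog n"
  shows "act \<theta> f \<in> homog (n + m)"
proof -
  obtain x where x: "\<theta> = abs_steenrod x" "\<forall>w\<in>Poly_Mapping.keys x. sum_list w = m"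
    using assms(1) by (auto simp: steenrod_homog_def)
  show ?thesis
    unfolding x(1) act_abs free_act_def
    by (intro lin_ext_in_subspace homog_subspace) (use x(2) foldr_Sq_homog [OF assms(2)] in auto)
qed

section \<open>Hit polynomials\<close>

text \<open>The column space of the hit matrix.\<close>

definition hit_space :: "nat \<Rightarrow> 'k::finite mpol set" where
  "hit_space d = F2.span ((\<lambda>(t, g). Sq (2 ^ t) (xpow g)) ` labels d)"

lemma hit_space_subspace: "F2.subspace (hit_space d)"
  by (simp add: hit_space_def)

lemma pm_expand_xpow: "f = (\<Sum>e\<in>Poly_Mapping.keys f. xpow e)"
  unfolding xpow_def by (rule f2_pm_expand)

lemma Sq_pow2_hit_space:
  assumes "f \<in> homog n"
  shows "Sq (2 ^ t) f \<in> hit_space (n + 2 ^ t)"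
proof -
  have "Sq (2 ^ t) f = (\<Sum>e\<in>Poly_Mapping.keys f. Sq (2 ^ t) (xpow e))"
    by (subst pm_expand_xpow) (rule additive.sum [OF additive_Sq])
  also have "\<dots> \<in> hit_space (n + 2 ^ t)"
    unfolding hit_space_def
    by (intro F2.span_sum F2.span_base) (use assms in \<open>force simp: labels_def homog_def\<close>)
  finally show ?thesis .
qed

lemma of_nat_bit_odd:
  assumes "odd n"
  shows "of_nat n = (1 :: bit)"
proof -
  obtain m where "n = 2 * m + 1" using assms by (rule oddE)
  then show ?thesis by simp
qed

text \<open>Since \<open>2\<^sup>s choose (a + 1)\<close> is even for \<open>0 < a + 1 < 2\<^sup>s\<close>, consecutive entries in row \<open>2\<^sup>s - 1\<close> of
  Pascal's triangle have the same parity, and the first entry is one.\<close>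

lemma odd_binomial_pow2_minus_1:
  assumes "a < 2 ^ s"
  shows "odd ((2 ^ s - 1) choose a)"
  using assms
proof (induction a)
  case (Suc a)
  have "Suc a * (2 ^ s choose Suc a) = 2 ^ s * ((2 ^ s - 1) choose a)"
    using binomial_absorption [of a "2 ^ s"] by simp
  then have dvd: "2 ^ s dvd Suc a * (2 ^ s choose Suc a)" by simp
  have "even (2 ^ s choose Suc a)"
  proof (rule ccontr)
    assume "odd (2 ^ s choose Suc a)"
    then have "coprime (2 ^ s) (2 ^ s choose Suc a)"
      by (simp only: coprime_power_left_iff coprime_left_2_iff_odd disj_commute simp_thms)
    with dvd have "2 ^ s dvd Suc a" by (simp only: coprime_dvd_mult_left_iff)
    then show False using Suc.prems by (simp add: nat_dvd_not_less)
  qed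
  moreover have "2 ^ s choose Suc a = ((2 ^ s - 1) choose a) + ((2 ^ s - 1) choose Suc a)"
    using binomial_Suc_Suc [of "2 ^ s - 1" a] by simp
  ultimately show ?case using Suc by simp
qed simp

text \<open>Every positive square is a sum of composites of squares \<open>Sq\<^bsup>2^t\<^esup>\<close>: if \<open>r\<close> is not a power of two, write \<open>r = a + b\<close>, where
  \<open>b = 2\<^sup>s\<close> is the largest power of two with \<open>b < r\<close>. The Adem relation for \<open>Sq\<^sup>a Sq\<^sup>b\<close> contains \<open>Sq\<^sup>r\<close> with
  the coefficient \<open>(b - 1) choose a\<close>, which is odd.
  All other terms begin with a square of smaller positive degree.\<close>

lemma Sq_hit_space:
  assumes "f \<in> homog n" "r > 0"
  shows "Sq r f \<in> hit_space (n + r)"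
  using assms
proof (induction r arbitrary: f n rule: less_induct)
  case (less r)
  obtain s where s: "2 ^ s \<le> r" "r < 2 ^ Suc s"
    using ex_power_ivl1 [of 2 r] less.prems(2) by auto
  show ?case
  proof (cases "r = 2 ^ s")
    case True
    then show ?thesis using Sq_pow2_hit_space less.prems by simp
  next
    case False
    define a b where "a = r - 2 ^ s" and "b = (2 ^ s :: nat)"
    have ab: "0 < a" "a < b" "r = a + b" using False s by (auto simp: a_def b_def)
    let ?u = "\<lambda>j. bscale (of_nat ((b - 1 - j) choose (a - 2 * j))) (Sq (a + b - j) (Sq j f))"
    have "odd ((b - 1) choose a)"
      using odd_binomial_pow2_minus_1 ab(2) by (simp add: b_def)
    then have one: "of_nat ((b - 1) choose a) = (1 :: bit)"
      by (rule of_nat_bit_odd)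
    have u0: "?u 0 = Sq r f"
      unfolding diff_zero mult_0_right one Sq_0 ab(3) by (rule F2.scale_one)
    have "Sq a (Sq b f) = (\<Sum>j\<le>a div 2. ?u j)"
      using ab by (intro Sq_adem) linarith
    also have "\<dots> = Sq r f + (\<Sum>j\<in>{..a div 2} - {0}. ?u j)"
      unfolding u0 [symmetric] by (rule sum.remove) simp_all
    finally have "Sq r f = Sq a (Sq b f) + (\<Sum>j\<in>{..a div 2} - {0}. ?u j)"
      by (simp only: add.assoc add_self add_0_right)
    moreover have "Sq a (Sq b f) \<in> hit_space (n + r)"
      using less.IH [of a "Sq b f" "n + b"] Sq_homog [OF less.prems(1), of b] ab by (simp add: add_ac)
    moreover have "?u j \<in> hit_space (n + r)" if "j \<in> {..a div 2} - {0}" for j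
    proof -
      have "Sq (a + b - j) (Sq j f) \<in> hit_space (n + j + (a + b - j))"
        using that ab by (intro less.IH Sq_homog less.prems) auto
      moreover have "n + j + (a + b - j) = n + r" using that ab by auto
      ultimately show ?thesis by (simp add: F2.subspace_scale hit_space_subspace)
    qed
    ultimately show ?thesis
      by (metis (no_types, lifting) F2.subspace_add F2.subspace_sum hit_space_subspace)
  qed
qed

text \<open>The homogeneous component of degree \<open>d\<close>. The generators \<open>act \<theta> f\<close> of the hit polynomials need not be
  homogeneous, so elements of \<open>hits\<close> of degree \<open>d\<close> are reached by projecting all generators.\<close>

definition hcomp :: "nat \<Rightarrow> 'k::finite mpol \<Rightarrow> 'k mpol" where
  "hcomp d = lin_ext (\<lambda>e. if mdeg e = d then xpow e else 0)"

lemma additive_hcomp: "additive (hcomp d)"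
  unfolding hcomp_def by (rule additive_lin_ext)

lemma hcomp_homog: "f \<in> homog n \<Longrightarrow> hcomp d f = (if n = d then f else 0)"
proof -
  assume f: "f \<in> homog n"
  have "hcomp d f = (\<Sum>e\<in>Poly_Mapping.keys f. if n = d then xpow e else 0)"
    unfolding hcomp_def lin_ext_def
    by (intro sum.cong refl) (use f in \<open>auto simp: homog_def bscale_def in_keys_iff\<close>)
  then show ?thesis using pm_expand_xpow [of f] by simp
qed

lemma hcomp_Sq: "r > 0 \<Longrightarrow> hcomp d (Sq r f) \<in> hit_space d"
proof -
  assume r: "r > 0"
  have "hcomp d (Sq r f) = (\<Sum>e\<in>Poly_Mapping.keys f. hcomp d (Sq r (xpow e)))"
    by (subst pm_expand_xpow)
      (rule additive.sum [OF additive_comp [OF additive_hcomp additive_Sq]])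
  also have "\<dots> \<in> hit_space d"
  proof (rule F2.subspace_sum [OF hit_space_subspace])
    fix e :: "'a mon"
    have "hcomp d (Sq r (xpow e)) = (if mdeg e + r = d then Sq r (xpow e) else 0)"
      by (intro hcomp_homog Sq_homog) simp
    then show "hcomp d (Sq r (xpow e)) \<in> hit_space d"
      using Sq_hit_space [OF _ r, of "xpow e" "mdeg e"] by (auto simp: F2.subspace_0 hit_space_subspace)
  qed
  finally show ?thesis .
qed

lemma hcomp_foldr_Sq:
  assumes "sum_list w > 0"
  shows "hcomp d (foldr Sq w f) \<in> hit_space d"
  using assms
proof (induction w)
  case (Cons r w)
  then show ?case by (cases "r = 0") (auto simp: hcomp_Sq)
qed simp

lemma hcomp_act:
  assumes "\<theta> \<in> augmentation_ideal"
  shows "hcomp d (act \<theta> f) \<in> hit_space d"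
  using assms unfolding augmentation_ideal_def
proof (induction rule: F2.span_induct_alt)
  case base
  then show ?case by (simp add: additive.zero [OF additive_hcomp] F2.subspace_0 hit_space_subspace)
next
  case (step c \<theta> \<eta>)
  then obtain n x where nx: "n > 0" "\<theta> = abs_steenrod x" "\<forall>w\<in>Poly_Mapping.keys x. sum_list w = n"
    by (auto simp: steenrod_homog_def)
  have "hcomp d (act \<theta> f)
      = (\<Sum>w\<in>Poly_Mapping.keys x. hcomp d (bscale (Poly_Mapping.lookup x w) (foldr Sq w f)))"
    unfolding nx(2) act_abs free_act_def lin_ext_def by (rule additive.sum [OF additive_hcomp])
  also have "\<dots> \<in> hit_space d"
    by (rule F2.subspace_sum [OF hit_space_subspace])
      (use nx in \<open>auto simp: bscale_def hcomp_foldr_Sq additive.zero [OF additive_hcomp] F2.subspace_0 hit_space_subspace\<close>)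
  finally show ?case
    using step.IH
    by (simp add: act_add additive.add [OF additive_hcomp] additive.zero [OF additive_hcomp] bscale_def F2.subspace_add hit_space_subspace)
qed

lemma Sq_in_hits: "r > 0 \<Longrightarrow> Sq r f \<in> hits"
proof -
  assume "r > 0"
  then have "SqA r \<in> augmentation_ideal"
    unfolding augmentation_ideal_def SqA_def steenrod_homog_def gen_sq_def
    by (intro F2.span_base UN_I [of r] imageI) auto
  then show ?thesis
    unfolding hits_def by (intro F2.span_base) (metis (mono_tags, lifting) act_SqA mem_Collect_eq)
qed

lemma hit_space_subset_homog: "hit_space d \<subseteq> homog d"
  unfolding hit_space_def
proof (rule F2.span_minimal [OF _ homog_subspace], safe)
  fix t and g :: "'a mon" assume "(t, g) \<in> labels d"
  then show "Sq (2 ^ t) (xpow g) \<in> homog d"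
    using Sq_homog [of "xpow g" "d - 2 ^ t" "2 ^ t"] by (simp add: labels_def)
qed

text \<open>Projecting a sum of values of the augmentation ideal to degree \<open>d\<close> leaves values of positive squares in
  degree \<open>d\<close>, and these lie in the column space.\<close>

lemma hits_homog: "hits \<inter> homog d = hit_space d"
proof (intro equalityI subsetI)
  fix f :: "'a mpol" assume f: "f \<in> hits \<inter> homog d"
  then have "f \<in> F2.span {act \<theta> f | \<theta> f. \<theta> \<in> augmentation_ideal}" by (simp add: hits_def)
  then have "hcomp d f \<in> hit_space d"
  proof (induction rule: F2.span_induct_alt)
    case base
    then show ?case by (simp add: additive.zero [OF additive_hcomp] F2.subspace_0 hit_space_subspace)
  next
    case (step c x y)
    then show ?case
      by (auto simp: additive.add [OF additive_hcomp] additive.zero [OF additive_hcomp] bscale_def hcomp_act F2.subspace_add hit_space_subspace)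
  qed
  then show "f \<in> hit_space d" using f hcomp_homog [of f d d] by simp
next
  fix f :: "'a mpol" assume f: "f \<in> hit_space d"
  moreover have "hit_space d \<subseteq> (hits :: 'a mpol set)"
    unfolding hit_space_def
    by (rule F2.span_minimal) (auto simp: Sq_in_hits, simp add: hits_def)
  ultimately show "f \<in> hits \<inter> homog d" using hit_space_subset_homog by blast
qed

lemma abs_cohits_eq_0_iff: "abs_cohits f = 0 \<longleftrightarrow> f \<in> hits"
  unfolding zero_cohits_def using cohits.abs_eq_iff [of f 0] by simp

lemma dim_cohits: "F2.dim (homog d :: 'k::finite mpol set)
    = F2.dim (hit_space d :: 'k mpol set) + F2.dim (cohits_deg d :: 'k cohits set)"
proof -
  have "additive (abs_cohits :: 'k mpol \<Rightarrow> _)"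
    by (simp add: additive_def plus_cohits.abs_eq)
  from f2_rank_nullity [OF this homog_finite homog_subspace, of d]
  have "F2.dim (homog d :: 'k mpol set)
    = F2.dim {f \<in> homog d. abs_cohits f = (0 :: 'k cohits)} + F2.dim (cohits_deg d :: 'k cohits set)"
    by (simp add: cohits_deg_def)
  moreover have "{f \<in> homog d. abs_cohits f = (0 :: 'k cohits)} = hit_space d"
    using hits_homog [of d] by (auto simp: abs_cohits_eq_0_iff)
  ultimately show ?thesis by simp
qed

section \<open>The first square and its contracting homotopy\<close>

lemma of_nat_bit: "of_nat n = (if odd n then 1 else 0 :: bit)"
  by (cases "odd n") (auto simp: of_nat_bit_odd elim: evenE)

lemma mdeg_eq_1: "{b :: 'k::finite mon. mdeg b = 1} = range (\<lambda>i. Poly_Mapping.single i 1)"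
proof (intro equalityI subsetI)
  fix b :: "'k mon" assume "b \<in> {b. mdeg b = 1}"
  then have "mdeg b = 1" by simp
  then show "b \<in> range (\<lambda>i. Poly_Mapping.single i 1)"
    by (cases b rule: mon_cases) (auto simp del: One_nat_def)
qed auto

lemma single_one_inj: "Poly_Mapping.single i (1::nat) = Poly_Mapping.single j 1 \<longleftrightarrow> i = j"
  by (metis lookup_single_eq lookup_single_not_eq zero_neq_one)

lemma Sq_1_xpow: "Sq 1 (xpow e) =
    (\<Sum>i\<in>UNIV. if odd (expo e i) then xpow (e + Poly_Mapping.single i 1) else 0)"
proof -
  have coeff: "(\<Prod>j\<in>UNIV. expo e j choose expo (Poly_Mapping.single i 1) j) = expo e i" for i
  proof -
    have "(\<Prod>j\<in>UNIV. expo e j choose expo (Poly_Mapping.single i 1) j) = (\<Prod>j\<in>UNIV. if j = i then expo e j else 1)"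
      by (intro prod.cong) (auto simp: lookup_single when_def)
    then show ?thesis by simp
  qed
  have "Sq 1 (xpow e) = (\<Sum>i\<in>UNIV. Poly_Mapping.single (e + Poly_Mapping.single i 1)
      (of_nat (\<Prod>j\<in>UNIV. expo e j choose expo (Poly_Mapping.single i 1) j)))"
    unfolding Sq_xpow mdeg_eq_1
    by (subst sum.reindex) (simp_all add: inj_on_def single_one_inj del: One_nat_def)
  then show ?thesis
    by (simp only: coeff of_nat_bit xpow_def if_distrib [of "Poly_Mapping.single _"] single_zero)
qed

lemma first_idx:
  assumes "e \<noteq> 0"
  shows "expo e (first_idx e) > 0" "j < first_idx e \<Longrightarrow> expo e j = 0"
proof -
  have ne: "{i. expo e i > 0} \<noteq> {}"
    using assms by (auto simp: poly_mapping_eq_iff fun_eq_iff)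
  then show "expo e (first_idx e) > 0"
    using Min_in [of "{i. expo e i > 0}"] by (simp add: first_idx_def)
  show "j < first_idx e \<Longrightarrow> expo e j = 0"
    using Min_le [of "{i. expo e i > 0}" j] by (fastforce simp: first_idx_def)
qed

lemma first_idx_eqI:
  assumes "expo e i > 0" "\<And>j. j < i \<Longrightarrow> expo e j = 0"
  shows "first_idx e = i"
  unfolding first_idx_def
proof (rule Min_eqI)
  fix j assume "j \<in> {i. expo e i > 0}"
  then show "i \<le> j" using assms(2) [of j] not_less by fastforce
qed (use assms in auto)

lemma first_idx_le: "expo e i > 0 \<Longrightarrow> first_idx e \<le> i"
  unfolding first_idx_def by (rule Min_le) auto

lemma additive_h_map: "additive h_map"
  unfolding h_map_def by (rule additive_lin_ext)

lemma additive_p_map: "additive p_map"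
  unfolding p_map_def by (intro additive_comp [OF additive_h_map] additive_Sq)

lemma h_map_xpow: "h_map (xpow e) = (if e \<noteq> 0 \<and> even (expo e (first_idx e))
    then xpow (e - Poly_Mapping.single (first_idx e) 1) else 0)"
  unfolding h_map_def xpow_def by (rule lin_ext_single)

lemma mon_minus_plus: "expo e i > 0 \<Longrightarrow> e - Poly_Mapping.single i 1 + Poly_Mapping.single i 1 = (e :: 'k mon)"
  by (rule poly_mapping_eqI) (auto simp: lookup_add lookup_minus lookup_single when_def)

lemma mon_plus_minus_swap: "expo e i > 0 \<Longrightarrow>
    e + Poly_Mapping.single j 1 - Poly_Mapping.single i 1 = e - Poly_Mapping.single i 1 + Poly_Mapping.single j (1::nat)"
  by (rule poly_mapping_eqI) (auto simp: lookup_add lookup_minus lookup_single when_def)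

lemma h_map_first_odd:
  assumes "f \<in> homog (Suc d)"
  shows "Poly_Mapping.keys (h_map f) \<subseteq> first_odd d"
proof -
  have "h_map f \<in> {f. Poly_Mapping.keys f \<subseteq> first_odd d}"
    unfolding h_map_def
  proof (intro lin_ext_in_subspace f2_keys_subspace)
    fix e assume "e \<in> Poly_Mapping.keys f"
    then have deg: "mdeg e = Suc d" using assms by (simp add: homog_def)
    define i where "i = first_idx e"
    define e' where "e' = e - Poly_Mapping.single i 1"
    have "e' \<in> first_odd d" if ev: "e \<noteq> 0" "even (expo e i)"
    proof -
      note i = first_idx [OF ev(1), folded i_def]
      have "e' + Poly_Mapping.single i 1 = e"
        unfolding e'_def using i(1) by (rule mon_minus_plus)
      then have "mdeg (e' + Poly_Mapping.single i 1) = Suc d" using deg by simp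
      then have d: "mdeg e' = d" by simp
      have ei: "expo e' i = expo e i - 1" by (simp add: e'_def lookup_minus)
      then have "odd (expo e' i)" using i(1) ev(2) by simp
      moreover have "expo e' j = 0" if "j < i" for j using i(2) that by (simp add: e'_def lookup_minus)
      ultimately have "first_idx e' = i" using first_idx_eqI odd_pos by blast
      then show ?thesis using d \<open>odd (expo e' i)\<close> by (auto simp: first_odd_def)
    qed
    then show "(if e \<noteq> 0 \<and> even (expo e (first_idx e))
        then xpow (e - Poly_Mapping.single (first_idx e) 1) else 0) \<in> {f. Poly_Mapping.keys f \<subseteq> first_odd d}"
      by (simp add: i_def e'_def xpow_def)
  qed
  then show ?thesis by simp
qed

lemma h_map_homog: "f \<in> homog (Suc d) \<Longrightarrow> h_map f \<in> homog d"
  using h_map_first_odd by (fastforce simp: homog_def first_odd_def)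

text \<open>Let \<open>i\<close> be the first index of \<open>e\<close>. Raising another exponent keeps the first index and its exponent,
  so \<open>h\<close> sees only the parity of that exponent. If it is odd, \<open>h x\<^sup>e = 0\<close> and the only term of \<open>Sq\<^sup>1 x\<^sup>e\<close>
  not killed by \<open>h\<close> raises the exponent at \<open>i\<close>, which \<open>h\<close> undoes. If it is even, \<open>Sq\<^sup>1 h x\<^sup>e\<close> is
  \<open>x\<^sup>e\<close> plus terms raising other odd exponents of \<open>h x\<^sup>e\<close>, and these are the terms of \<open>h Sq\<^sup>1 x\<^sup>e\<close>.\<close>

lemma h_map_homotopy_xpow:
  assumes "e \<noteq> 0"
  shows "Sq 1 (h_map (xpow e)) + h_map (Sq 1 (xpow e)) = xpow e"
proof -
  define i where "i = first_idx e"
  let ?s = "\<lambda>j. Poly_Mapping.single j (1::nat)"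
  note i = first_idx [OF assms, folded i_def]
  have h: "h_map (xpow (e + ?s j)) = (if j = i then xpow e else if even (expo e i) then xpow (e + ?s j - ?s i) else 0)"
    if "odd (expo e j)" for j
  proof -
    have "i \<le> j" unfolding i_def using that by (intro first_idx_le odd_pos)
    then have "first_idx (e + ?s j) = i"
      using i by (intro first_idx_eqI) (auto simp: lookup_add lookup_single when_def)
    moreover have "e + ?s j \<noteq> 0"
      using i(1) by (auto simp: poly_mapping_eq_iff fun_eq_iff lookup_add)
    ultimately show ?thesis
      using that by (auto simp: h_map_xpow lookup_add lookup_single when_def)
  qed
  have hSq: "h_map (Sq 1 (xpow e)) = (\<Sum>j\<in>UNIV. if odd (expo e j)
      then (if j = i then xpow e else if even (expo e i) then xpow (e + ?s j - ?s i) else 0) else 0)"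
    unfolding Sq_1_xpow additive.sum [OF additive_h_map]
    by (intro sum.cong refl) (simp add: h additive.zero [OF additive_h_map] del: One_nat_def)
  show ?thesis
  proof (cases "odd (expo e i)")
    case True
    then have "h_map (Sq 1 (xpow e)) = (\<Sum>j\<in>UNIV. if j = i then xpow e else 0)"
      unfolding hSq by (intro sum.cong refl) auto
    then show ?thesis using True by (simp add: h_map_xpow i_def)
  next
    case False
    let ?T = "\<Sum>j\<in>UNIV. if odd (expo e j) then xpow (e + ?s j - ?s i) else 0"
    have "h_map (Sq 1 (xpow e)) = ?T"
      unfolding hSq by (intro sum.cong refl) (use False in auto)
    moreover have "Sq 1 (h_map (xpow e)) = Sq 1 (xpow (e - ?s i))"
      using False assms by (simp add: h_map_xpow i_def)
    moreover have "Sq 1 (xpow (e - ?s i)) = (\<Sum>j\<in>UNIV. (if j = i then xpow e else 0)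
        + (if odd (expo e j) then xpow (e + ?s j - ?s i) else 0))"
      unfolding Sq_1_xpow
    proof (intro sum.cong refl)
      fix j
      show "(if odd (expo (e - ?s i) j) then xpow (e - ?s i + ?s j) else 0) = (if j = i then xpow e else 0)
        + (if odd (expo e j) then xpow (e + ?s j - ?s i) else 0)"
        using i(1) False mon_minus_plus [OF i(1)] mon_plus_minus_swap [OF i(1), of j]
        by (cases "j = i") (auto simp: lookup_minus lookup_single when_def)
    qed
    then have "Sq 1 (xpow (e - ?s i)) = xpow e + ?T" by (simp add: sum.distrib)
    ultimately show ?thesis by (simp add: add.assoc)
  qed
qed

lemma h_map_homotopy:
  fixes f :: "'k::{finite,linorder} mpol"
  assumes "f \<in> homog d" "d > 0"
  shows "Sq 1 (h_map f) + h_map (Sq 1 f) = f"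
proof -
  have add: "additive (\<lambda>f :: 'k mpol. Sq 1 (h_map f) + h_map (Sq 1 f))"
    by (intro additive_plus additive_comp [OF additive_Sq] additive_comp [OF additive_h_map]
        additive_h_map additive_Sq)
  have f: "f = (\<Sum>e\<in>Poly_Mapping.keys f. xpow e)" by (rule pm_expand_xpow)
  have "Sq 1 (h_map f) + h_map (Sq 1 f)
      = (\<Sum>e\<in>Poly_Mapping.keys f. Sq 1 (h_map (xpow e)) + h_map (Sq 1 (xpow e)))"
    using additive.sum [OF add, of xpow "Poly_Mapping.keys f"] f by simp
  also have "\<dots> = (\<Sum>e\<in>Poly_Mapping.keys f. xpow e)"
    using assms by (intro sum.cong refl h_map_homotopy_xpow) (auto simp: homog_def)
  finally show ?thesis using f by simp
qed

lemma ker_Sq_1: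
  fixes f :: "'k::{finite,linorder} mpol"
  assumes "f \<in> homog d" "d > 0" "Sq 1 f = 0"
  shows "f \<in> Sq 1 ` homog (d - 1)"
  using h_map_homotopy [OF assms(1,2)] h_map_homog [of f "d - 1"] assms
  by (auto simp: additive.zero [OF additive_h_map] intro!: image_eqI [of _ _ "h_map f"])

lemma ker_p_map:
  assumes "d > 0"
  shows "{f :: 'k::{finite,linorder} mpol. f \<in> homog d \<and> p_map f = 0} = Sq 1 ` homog (d - 1)"
proof (intro equalityI subsetI)
  fix f :: "'k mpol" assume "f \<in> {f \<in> homog d. p_map f = 0}"
  then have f: "f \<in> homog d" "h_map (Sq 1 f) = 0" by (auto simp: p_map_def)
  then have "Sq 1 (h_map f) = f" using h_map_homotopy [OF f(1) assms] by simp
  moreover have "h_map f \<in> homog (d - 1)" using h_map_homog [of f "d - 1"] f(1) assms by simp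
  ultimately show "f \<in> Sq 1 ` homog (d - 1)" by (metis imageI)
next
  fix f :: "'k mpol" assume "f \<in> Sq 1 ` homog (d - 1)"
  then show "f \<in> {f \<in> homog d. p_map f = 0}"
    using Sq_homog [of _ "d - 1" 1] assms
    by (auto simp: p_map_def additive.zero [OF additive_h_map] simp del: One_nat_def)
qed

section \<open>The rank of the hit matrix\<close>

lemma mat_col_eq:
  assumes "finite (rows A)" "Poly_Mapping.keys f \<subseteq> rows A" "\<And>r. entry A r c = Poly_Mapping.lookup f r"
  shows "mat_col A c = f"
proof (rule poly_mapping_eqI)
  fix r
  show "Poly_Mapping.lookup (mat_col A c) r = Poly_Mapping.lookup f r"
    using assms by (auto simp: mat_col_def lookup_sum lookup_single when_def in_keys_iff)
qed

lemma finite_labels: "finite (labels d :: (nat \<times> 'k::finite mon) set)"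
proof (rule finite_subset)
  show "labels d \<subseteq> {..d} \<times> (\<Union>n\<in>{..d}. {g :: 'k mon. mdeg g = n})"
  proof
    fix c :: "nat \<times> 'k mon" assume "c \<in> labels d"
    then obtain t g where c: "c = (t, g)" and tg: "(t, g) \<in> labels d" by (cases c) auto
    have "t < 2 ^ t" by (rule less_exp)
    also have "2 ^ t \<le> d" using tg by (simp add: labels_def)
    finally have "t < d" .
    then show "c \<in> {..d} \<times> (\<Union>n\<in>{..d}. {g :: 'k mon. mdeg g = n})"
      using tg by (simp add: c labels_def)
  qed
qed (auto intro: finite_mdeg)

lemma hit_map_superset:
  assumes "finite A" "Poly_Mapping.keys v \<subseteq> A"
  shows "hit_map v = (\<Sum>t\<in>A. Sq (2 ^ t) (Poly_Mapping.lookup v t))"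
  unfolding hit_map_def
  by (rule sum.mono_neutral_left) (use assms in \<open>auto simp: in_keys_iff\<close>)

lemma additive_hit_map: "additive hit_map"
proof
  fix u v :: "nat \<Rightarrow>\<^sub>0 'a mpol"
  let ?A = "Poly_Mapping.keys u \<union> Poly_Mapping.keys v"
  have "hit_map (u + v) = (\<Sum>t\<in>?A. Sq (2 ^ t) (Poly_Mapping.lookup (u + v) t))"
    by (rule hit_map_superset) (use Poly_Mapping.keys_add [of u v] in auto)
  then show "hit_map (u + v) = hit_map u + hit_map v"
    by (simp add: lookup_add Sq_add sum.distrib hit_map_superset [of ?A])
qed

lemma hit_map_single [simp]: "hit_map (Poly_Mapping.single t g) = Sq (2 ^ t) g"
  by (subst hit_map_superset [of "{t}"]) auto

lemma hit_map_label [simp]: "hit_map (label_vec (t, g)) = Sq (2 ^ t) (xpow g)"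
  by (simp add: label_vec_def)

lemma Sq_label_homog: "(t, g) \<in> labels d \<Longrightarrow> Sq (2 ^ t) (xpow g) \<in> homog d"
  using Sq_homog [of "xpow g" "d - 2 ^ t" "2 ^ t"] by (simp add: labels_def)

lemma mat_col_hit_matrix: "(t, g) \<in> labels d \<Longrightarrow> mat_col (hit_matrix d) (t, g) = Sq (2 ^ t) (xpow g)"
  using Sq_label_homog [of t g d]
  by (intro mat_col_eq) (simp_all add: hit_matrix_def finite_mdeg homog_keys)

lemma mat_rank_hit_matrix:
  "mat_rank (hit_matrix d :: ('k::finite mon, nat \<times> 'k mon) lmatrix) = F2.dim (hit_space d :: 'k mpol set)"
proof -
  have "mat_col (hit_matrix d) ` cols (hit_matrix d) = (\<lambda>(t, g). Sq (2 ^ t) (xpow g)) ` (labels d :: (nat \<times> 'k mon) set)"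
    by (rule image_cong) (auto simp: mat_col_hit_matrix, simp_all add: hit_matrix_def)
  then show ?thesis by (simp add: mat_rank_def hit_space_def)
qed

lemma finite_first_odd: "finite (first_odd d)"
  by (rule finite_subset [OF _ finite_mdeg [of d]]) (auto simp: first_odd_def)

lemma mat_col_reduced_matrix:
  assumes "(t, g) \<in> labels d"
  shows "mat_col (reduced_matrix d) (t, g) = p_map (Sq (2 ^ t) (xpow g))"
proof (rule mat_col_eq)
  show "Poly_Mapping.keys (p_map (Sq (2 ^ t) (xpow g))) \<subseteq> rows (reduced_matrix d)"
    using h_map_first_odd [of _ d] Sq_homog [OF Sq_label_homog [OF assms], of 1]
    by (simp add: p_map_def reduced_matrix_def)
qed (simp_all add: reduced_matrix_def finite_first_odd)

text \<open>On the column space \<open>p_map\<close> has the image of the first square as its kernel, of dimension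
  \<open>rho (d - 1)\<close>, and its image is the column space of the reduced matrix: the columns with \<open>t = 0\<close> go to
  zero since \<open>Sq\<^sup>1 Sq\<^sup>1 = 0\<close>.\<close>

lemma mat_rank_hit_reduced:
  assumes "d > 0"
  shows "mat_rank (hit_matrix d :: ('k::{finite,linorder} mon, nat \<times> 'k mon) lmatrix)
    = rho TYPE('k) (d - 1) + mat_rank (reduced_matrix d :: ('k mon, nat \<times> 'k mon) lmatrix)"
proof -
  let ?H = "hit_space d :: 'k mpol set" and ?M = "reduced_matrix d :: ('k mon, nat \<times> 'k mon) lmatrix"
  have "{x \<in> ?H. p_map x = 0} = Sq 1 ` homog (d - 1)"
  proof (intro equalityI subsetI)
    fix x assume "x \<in> {x \<in> ?H. p_map x = 0}"
    then have "x \<in> {f. f \<in> homog d \<and> p_map f = 0}" using hit_space_subset_homog by blast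
    then show "x \<in> Sq 1 ` homog (d - 1)" unfolding ker_p_map [OF assms] .
  next
    fix x assume x: "x \<in> Sq 1 ` (homog (d - 1) :: 'k mpol set)"
    then obtain f where "f \<in> homog (d - 1)" "x = Sq (2 ^ 0) f" by auto
    then have "x \<in> hit_space (d - 1 + 2 ^ 0)" using Sq_pow2_hit_space by blast
    moreover have "d - 1 + 2 ^ 0 = d" using assms by simp
    ultimately have "x \<in> ?H" by simp
    then show "x \<in> {x \<in> ?H. p_map x = 0}"
      using x unfolding ker_p_map [OF assms, symmetric] by simp
  qed
  moreover have "p_map ` ?H = F2.span (mat_col ?M ` cols ?M)"
  proof -
    let ?L = "labels d :: (nat \<times> 'k mon) set" and ?g = "\<lambda>(t, g). p_map (Sq (2 ^ t) (xpow g))"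
    have "p_map ` ?H = F2.span (?g ` ?L)"
      unfolding hit_space_def additive_span_image [OF additive_p_map] image_image
      by (simp add: case_prod_beta)
    also have "\<dots> = F2.span (insert 0 (?g ` {(t, g) \<in> ?L. 1 \<le> t}))"
    proof -
      have z: "p_map (Sq 1 f) = 0" for f :: "'k mpol"
        by (simp add: p_map_def additive.zero [OF additive_h_map] del: One_nat_def)
      have "p_map (Sq (2 ^ t) (xpow g)) \<in> insert 0 (?g ` {(t, g) \<in> ?L. 1 \<le> t})" if "(t, g) \<in> ?L" for t g
      proof (cases "t = 0")
        case True
        then have "p_map (Sq (2 ^ t) (xpow g)) = 0" using z by (simp only: power_0)
        then show ?thesis by simp
      next
        case False
        then have "(t, g) \<in> {(t, g) \<in> ?L. 1 \<le> t}" using that by simp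
        then have "?g (t, g) \<in> ?g ` {(t, g) \<in> ?L. 1 \<le> t}" by (rule imageI)
        then show ?thesis by simp
      qed
      then have "insert 0 (?g ` ?L) = insert 0 (?g ` {(t, g) \<in> ?L. 1 \<le> t})" by auto
      then show ?thesis
        using F2.span_insert_0 [of "?g ` ?L"] by (simp only:)
    qed
    also have "\<dots> = F2.span (mat_col ?M ` cols ?M)"
    proof -
      have "mat_col ?M ` cols ?M = ?g ` {(t, g) \<in> ?L. 1 \<le> t}"
        by (rule image_cong) (auto simp: mat_col_reduced_matrix, auto simp: reduced_matrix_def)
      then show ?thesis by simp
    qed
    finally show ?thesis .
  qed
  moreover have "finite ?H" using homog_finite hit_space_subset_homog finite_subset by blast
  moreover from this have "F2.dim ?H = F2.dim {x \<in> ?H. p_map x = 0} + F2.dim (p_map ` ?H)"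
    by (rule f2_rank_nullity [OF additive_p_map _ hit_space_subspace])
  ultimately show ?thesis
    unfolding mat_rank_hit_matrix mat_rank_def [of ?M] rho_def by simp
qed

section \<open>Acyclic pivots and leading rows\<close>

lemma lookup_mat_col:
  "finite (rows A) \<Longrightarrow> Poly_Mapping.lookup (mat_col A c) r = (if r \<in> Supp A c then 1 else 0)"
  by (auto simp: mat_col_def lookup_sum lookup_single when_def Supp_def)

text \<open>By acyclicity some pivot row of \<open>S\<close> has no arrow to another pivot row of \<open>S\<close>; it lies in the support
  of its own column only, so its entry in the sum is one.\<close>

lemma acyclic_pivots_sum_nonzero:
  assumes piv: "acyclic_pivots A C p" and fin: "finite (rows A)" "finite C" and S: "S \<subseteq> C" "S \<noteq> {}"
  shows "(\<Sum>c\<in>S. mat_col A c) \<noteq> 0"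
proof -
  let ?R = "{(r, p c) | r c. c \<in> C \<and> r \<in> Supp A c - {p c}}"
  from piv have inj: "inj_on p C" and acyc: "acyclic ?R" and p: "\<And>c. c \<in> C \<Longrightarrow> p c \<in> Supp A c"
    by (auto simp: acyclic_pivots_def)
  have "finite ?R"
    by (rule finite_subset [of _ "rows A \<times> p ` C"]) (use fin in \<open>auto simp: Supp_def\<close>)
  then have "wf (?R\<inverse>)" using acyc by (rule finite_acyclic_wf_converse)
  then obtain z where z: "z \<in> p ` S" "\<And>y. (y, z) \<in> ?R\<inverse> \<Longrightarrow> y \<notin> p ` S"
    using S(2) by (rule_tac wfE_min' [of "?R\<inverse>" "p ` S"]) auto
  then obtain c where c: "c \<in> S" "z = p c" by blast
  have other: "p c \<notin> Supp A c'" if "c' \<in> S" "c' \<noteq> c" for c'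
  proof
    assume "p c \<in> Supp A c'"
    moreover have "p c \<noteq> p c'" using inj that c S by (auto simp: inj_on_def)
    ultimately have "(p c', z) \<in> ?R\<inverse>" using that S c by auto
    then show False using z(2) that by blast
  qed
  have "Poly_Mapping.lookup (\<Sum>c\<in>S. mat_col A c) (p c) = (\<Sum>c'\<in>S. if c' = c then 1 else 0)"
    unfolding lookup_sum lookup_mat_col [OF fin(1)]
    by (intro sum.cong refl) (use p other c S in auto)
  also have "\<dots> = 1" using c S fin(2) finite_subset by fastforce
  finally show ?thesis by force
qed

text \<open>If two sets of pivot columns had the same sum, then their symmetric difference would sum to zero.
  So the \<open>2\<^sup>n\<close> subsets of \<open>n\<close> pivot columns give distinct elements of the column space.\<close>

lemma acyclic_pivots_card_le_rank:
  assumes piv: "acyclic_pivots A C p" and fin: "finite (rows A)" "finite (cols A)"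
  shows "card C \<le> mat_rank A"
proof -
  let ?f = "\<lambda>S. \<Sum>c\<in>S. mat_col A c" and ?V = "F2.span (mat_col A ` cols A)"
  have C: "C \<subseteq> cols A" using piv by (auto simp: acyclic_pivots_def nonzero_cols_def)
  then have fC: "finite C" using fin(2) finite_subset by blast
  have "inj_on ?f (Pow C)"
  proof (rule inj_onI)
    fix S T assume ST: "S \<in> Pow C" "T \<in> Pow C" and eq: "?f S = ?f T"
    then have fST: "finite S" "finite T" using fC finite_subset by blast+
    have "?f ((S - T) \<union> (T - S)) = ?f (S - T) + ?f (T - S)"
      using fST by (intro sum.union_disjoint) auto
    also have "\<dots> = (?f (S \<inter> T) + ?f (S - T)) + (?f (T \<inter> S) + ?f (T - S))"
    proof -
      have "x + y = (z + x) + (z + y)" for x y z :: "'a \<Rightarrow>\<^sub>0 bit"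
      proof -
        have "(z + x) + (z + y) = (z + z) + (x + y)" by (simp only: add_ac)
        then show ?thesis by simp
      qed
      then show ?thesis unfolding Int_commute [of T S] .
    qed
    also have "\<dots> = 0"
      using fST eq by (simp add: sum.Int_Diff [symmetric])
    finally have "?f ((S - T) \<union> (T - S)) = 0" .
    then have "(S - T) \<union> (T - S) = {}"
      using acyclic_pivots_sum_nonzero [OF piv fin(1) fC, of "(S - T) \<union> (T - S)"] ST by auto
    then show "S = T" by auto
  qed
  moreover have "?f ` Pow C \<subseteq> ?V"
    using C by (auto intro!: F2.span_sum intro: F2.span_base)
  moreover have fV: "finite ?V" using fin(2) by (intro f2_finite_span) auto
  ultimately have "card (Pow C) \<le> card ?V" by (metis card_inj_on_le)
  then have "2 ^ card C \<le> (2::nat) ^ mat_rank A"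
    using f2_card_subspace [OF fV F2.subspace_span] fC by (simp add: card_Pow mat_rank_def)
  then show ?thesis by simp
qed

lemma tau_set_finite:
  assumes "finite (cols A)"
  shows "finite {card C | C. \<exists>p. acyclic_pivots A C p}"
  by (rule finite_subset [of _ "card ` Pow (cols A)"])
    (use assms in \<open>auto simp: acyclic_pivots_def nonzero_cols_def\<close>)

lemma tau_le_rank:
  assumes "finite (rows A)" "finite (cols A)"
  shows "tau A \<le> mat_rank A"
proof -
  have "acyclic_pivots A {} undefined" by (simp add: acyclic_pivots_def acyclic_def)
  then have "{card C | C. \<exists>p. acyclic_pivots A C p} \<noteq> {}" by blast
  then show ?thesis
    unfolding tau_def using tau_set_finite [OF assms(2)] acyclic_pivots_card_le_rank [OF _ assms]
    by (subst Max_le_iff) blast+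
qed

text \<open>Choosing one column for each leading row gives pivots whose arrows all increase in the
  order, hence no cycle can occur.\<close>

lemma lead_count_le_tau:
  assumes ord: "irreflp prec" "transp prec" "totalp prec" and fin: "finite (rows A)" "finite (cols A)"
  shows "lead_count prec A \<le> tau A"
proof -
  have LM: "LM prec A c \<in> Supp A c \<and> (\<forall>s\<in>Supp A c. s \<noteq> LM prec A c \<longrightarrow> prec s (LM prec A c))"
    if nz: "c \<in> nonzero_cols A" for c
  proof -
    have fS: "finite (Supp A c)" using fin(1) by (simp add: Supp_def)
    have max: "\<exists>r\<in>S. \<forall>s\<in>S. s \<noteq> r \<longrightarrow> prec s r" if "finite S" "S \<noteq> {}" for S
      using that
    proof (induction rule: finite_ne_induct)
      case (insert x S)
      then obtain r where r: "r \<in> S" "\<forall>s\<in>S. s \<noteq> r \<longrightarrow> prec s r" by blast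
      then have "x \<noteq> r" using insert by auto
      then consider "prec x r" | "prec r x" using ord(3) by (auto simp: totalp_on_def)
      then show ?case
      proof cases
        case 2
        then have "\<forall>s\<in>S. prec s x" using r ord(2) unfolding transp_def by metis
        then show ?thesis by blast
      qed (use r in blast)
    qed simp
    have uni: "\<exists>!r. r \<in> Supp A c \<and> (\<forall>s\<in>Supp A c. s \<noteq> r \<longrightarrow> prec s r)"
    proof -
      obtain r where r: "r \<in> Supp A c" "\<forall>s\<in>Supp A c. s \<noteq> r \<longrightarrow> prec s r"
        using max [OF fS] nz by (auto simp: nonzero_cols_def)
      show ?thesis
      proof (rule ex1I [of _ r])
        fix r' assume r': "r' \<in> Supp A c \<and> (\<forall>s\<in>Supp A c. s \<noteq> r' \<longrightarrow> prec s r')"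
        show "r' = r"
        proof (rule ccontr)
          assume "r' \<noteq> r"
          then have "prec r' r" "prec r r'" using r r' by auto
          then have "prec r r" using ord(2) by (blast dest: transpD)
          then show False using ord(1) by (simp add: irreflp_def)
        qed
      qed (use r in blast)
    qed
    show ?thesis unfolding LM_def by (rule theI' [OF uni])
  qed
  obtain C where C: "C \<subseteq> nonzero_cols A" "inj_on (LM prec A) C" "LM prec A ` nonzero_cols A = LM prec A ` C"
    using subset_image_inj [of "LM prec A ` nonzero_cols A" "LM prec A" "nonzero_cols A"] by blast
  let ?R = "{(r, LM prec A c) | r c. c \<in> C \<and> r \<in> Supp A c - {LM prec A c}}"
  have "acyclic ?R"
  proof -
    have "prec a b" if "(a, b) \<in> ?R\<^sup>+" for a b
      using that
    proof induction
      case (base b)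
      then show ?case using LM C(1) by blast
    next
      case (step b c)
      then have "prec b c" using LM C(1) by blast
      then show ?case using step.IH transpD [OF ord(2)] by blast
    qed
    then show ?thesis using ord(1) unfolding acyclic_def irreflp_def by blast
  qed
  then have "acyclic_pivots A C (LM prec A)"
    using C LM by (auto simp: acyclic_pivots_def)
  then have "card C \<le> tau A"
    unfolding tau_def by (intro Max_ge tau_set_finite fin) blast
  then show ?thesis using C by (simp add: lead_count_def card_image)
qed

section \<open>The four standard orders are total orders\<close>

lemma irreflp_lex_less: "irreflp lex_less"
  and irreflp_degrevlex_less: "irreflp degrevlex_less"
  by (auto simp: irreflp_def lex_less_def degrevlex_less_def)

lemma transp_lex_less: "transp lex_less"
proof (rule transpI)
  fix a b c :: "'a mon" assume "lex_less a b" "lex_less b c"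
  then obtain i j where "\<forall>k<i. expo a k = expo b k" "expo a i < expo b i"
    "\<forall>k<j. expo b k = expo c k" "expo b j < expo c j" by (auto simp: lex_less_def)
  then show "lex_less a c"
    unfolding lex_less_def by (intro exI [of _ "min i j"]) (cases i j rule: linorder_cases; auto)
qed

lemma transp_degrevlex_less: "transp degrevlex_less"
proof (rule transpI)
  fix a b c :: "'a mon" assume "degrevlex_less a b" "degrevlex_less b c"
  then obtain i j where "\<forall>k>i. expo a k = expo b k" "expo a i > expo b i"
    "\<forall>k>j. expo b k = expo c k" "expo b j > expo c j" by (auto simp: degrevlex_less_def)
  then show "degrevlex_less a c"
    unfolding degrevlex_less_def by (intro exI [of _ "max i j"]) (cases i j rule: linorder_cases; auto)
qed

lemma totalp_lex_less: "totalp (lex_less :: 'k::{finite,linorder} mon \<Rightarrow> _)"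
proof (rule totalpI)
  fix a b :: "'k mon" assume "a \<noteq> b"
  define D where "D = {i. expo a i \<noteq> expo b i}"
  have "D \<noteq> {}" using \<open>a \<noteq> b\<close> by (auto simp: D_def poly_mapping_eq_iff fun_eq_iff)
  then have "Min D \<in> D" by simp
  moreover have "\<forall>j<Min D. j \<notin> D"
  proof safe
    fix j assume "j < Min D" "j \<in> D"
    have "Min D \<le> j" using \<open>j \<in> D\<close> by (intro Min_le) simp_all
    from leD [OF this] \<open>j < Min D\<close> show False by (rule notE)
  qed
  ultimately obtain m where "m \<in> D" "\<forall>j<m. j \<notin> D" by blast
  then have m: "expo a m \<noteq> expo b m" "\<forall>j<m. expo a j = expo b j" by (auto simp: D_def)
  from m(1) consider "expo a m < expo b m" | "expo b m < expo a m" by linarith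
  then show "lex_less a b \<or> lex_less b a"
    using m(2) by cases (auto simp: lex_less_def intro: exI [of _ m])
qed

lemma totalp_degrevlex_less: "totalp (degrevlex_less :: 'k::{finite,linorder} mon \<Rightarrow> _)"
proof (rule totalpI)
  fix a b :: "'k mon" assume "a \<noteq> b"
  define D where "D = {i. expo a i \<noteq> expo b i}"
  have "D \<noteq> {}" using \<open>a \<noteq> b\<close> by (auto simp: D_def poly_mapping_eq_iff fun_eq_iff)
  then have "Max D \<in> D" by simp
  moreover have "\<forall>j>Max D. j \<notin> D"
  proof safe
    fix j assume "Max D < j" "j \<in> D"
    have "j \<le> Max D" using \<open>j \<in> D\<close> by (intro Max_ge) simp_all
    from leD [OF this] \<open>Max D < j\<close> show False by (rule notE)
  qed
  ultimately obtain m where "m \<in> D" "\<forall>j>m. j \<notin> D" by blast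
  then have m: "expo a m \<noteq> expo b m" "\<forall>j>m. expo a j = expo b j" by (auto simp: D_def)
  from m(1) consider "expo a m < expo b m" | "expo b m < expo a m" by linarith
  then show "degrevlex_less a b \<or> degrevlex_less b a"
    using m(2) by cases (auto simp: degrevlex_less_def intro: exI [of _ m])
qed

text \<open>The two weight orders are lexicographic products of a comparison of weights with the exponent
  order; \<open>tie_break_order\<close> treats both.\<close>

definition weights_less_left :: "'k::finite mon \<Rightarrow> 'k mon \<Rightarrow> bool" where
  "weights_less_left a b \<longleftrightarrow> (\<exists>j\<ge>1. (\<forall>i. 1 \<le> i \<and> i < j \<longrightarrow> weight i a = weight i b) \<and> weight j a < weight j b)"

definition weights_less_right :: "'k::finite mon \<Rightarrow> 'k mon \<Rightarrow> bool" where
  "weights_less_right a b \<longleftrightarrow> (\<exists>j\<ge>1. (\<forall>i>j. weight i a = weight i b) \<and> weight j a > weight j b)"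

definition weights_eq :: "'k::finite mon \<Rightarrow> 'k mon \<Rightarrow> bool" where
  "weights_eq a b \<longleftrightarrow> (\<forall>j\<ge>1. weight j a = weight j b)"

lemma tie_break_order:
  assumes P: "irreflp P" "transp P"
    and E: "\<And>a b c. P a b \<Longrightarrow> E b c \<Longrightarrow> P a c" "\<And>a b c. E a b \<Longrightarrow> P b c \<Longrightarrow> P a c"
      "\<And>a b c. E a b \<Longrightarrow> E b c \<Longrightarrow> E a c" "\<And>a b. E a b \<Longrightarrow> E b a"
      "\<And>a b. \<not> E a b \<Longrightarrow> P a b \<or> P b a"
    and Q: "irreflp Q" "transp Q" "totalp Q"
    and prec: "prec = (\<lambda>a b. P a b \<or> E a b \<and> Q a b)"
  shows "irreflp prec" "transp prec" "totalp prec"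
proof -
  show "irreflp prec" using P(1) Q(1) by (simp add: irreflp_def prec)
  show "transp prec"
  proof (rule transpI)
    fix a b c assume "prec a b" "prec b c"
    then consider "P a b" "P b c" | "P a b" "E b c" | "E a b" "P b c" | "E a b" "Q a b" "E b c" "Q b c"
      unfolding prec by blast
    then show "prec a c"
    proof cases
      case 1
      then show ?thesis using transpD [OF P(2)] unfolding prec by blast
    next
      case 4
      then show ?thesis using transpD [OF Q(2)] E(3) unfolding prec by blast
    qed (use E(1,2) in \<open>auto simp: prec\<close>)
  qed
  show "totalp prec"
  proof (rule totalpI)
    fix a b :: 'a assume "a \<noteq> b"
    then have "Q a b \<or> Q b a" using Q(3) by (simp add: totalp_on_def)
    then show "prec a b \<or> prec b a" using E(4,5) unfolding prec by blast
  qed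
qed

lemma weights_less_left_trans: "transp weights_less_left"
proof (rule transpI)
  fix a b c :: "'a mon" assume "weights_less_left a b" "weights_less_left b c"
  then obtain i j where "1 \<le> i" "\<forall>k. 1 \<le> k \<and> k < i \<longrightarrow> weight k a = weight k b" "weight i a < weight i b"
    "1 \<le> j" "\<forall>k. 1 \<le> k \<and> k < j \<longrightarrow> weight k b = weight k c" "weight j b < weight j c"
    by (auto simp: weights_less_left_def)
  then show "weights_less_left a c"
    unfolding weights_less_left_def by (intro exI [of _ "min i j"]) (cases i j rule: linorder_cases; auto)
qed

lemma weights_less_right_trans: "transp weights_less_right"
proof (rule transpI)
  fix a b c :: "'a mon" assume "weights_less_right a b" "weights_less_right b c"
  then obtain i j where "1 \<le> i" "\<forall>k>i. weight k a = weight k b" "weight i a > weight i b"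
    "1 \<le> j" "\<forall>k>j. weight k b = weight k c" "weight j b > weight j c"
    by (auto simp: weights_less_right_def)
  then show "weights_less_right a c"
    unfolding weights_less_right_def by (intro exI [of _ "max i j"]) (cases i j rule: linorder_cases; auto)
qed

lemma weights_less_left_total:
  assumes "\<not> weights_eq a b"
  shows "weights_less_left a b \<or> weights_less_left b a"
proof -
  let ?D = "\<lambda>j. j \<ge> 1 \<and> weight j a \<noteq> weight j b"
  have "\<exists>j. ?D j" using assms by (auto simp: weights_eq_def)
  then obtain m where m: "?D m" "\<forall>i<m. \<not> ?D i" using exists_least_iff [of ?D] by blast
  then have low: "weight i a = weight i b" if "1 \<le> i \<and> i < m" for i using that by blast
  from m(1) consider "weight m a < weight m b" | "weight m b < weight m a" by linarith
  then show ?thesis unfolding weights_less_left_def 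
  proof cases
    case 1
    then have "\<exists>j\<ge>1. (\<forall>i. 1 \<le> i \<and> i < j \<longrightarrow> weight i a = weight i b) \<and> weight j a < weight j b"
      using m(1) low by (intro exI [of _ m]) simp
    then show "(\<exists>j\<ge>1. (\<forall>i. 1 \<le> i \<and> i < j \<longrightarrow> weight i a = weight i b) \<and> weight j a < weight j b) \<or>
        (\<exists>j\<ge>1. (\<forall>i. 1 \<le> i \<and> i < j \<longrightarrow> weight i b = weight i a) \<and> weight j b < weight j a)" ..
  next
    case 2
    then have "\<exists>j\<ge>1. (\<forall>i. 1 \<le> i \<and> i < j \<longrightarrow> weight i b = weight i a) \<and> weight j b < weight j a"
      using m(1) low by (intro exI [of _ m]) simp
    then show "(\<exists>j\<ge>1. (\<forall>i. 1 \<le> i \<and> i < j \<longrightarrow> weight i a = weight i b) \<and> weight j a < weight j b) \<or>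
        (\<exists>j\<ge>1. (\<forall>i. 1 \<le> i \<and> i < j \<longrightarrow> weight i b = weight i a) \<and> weight j b < weight j a)" ..
  qed
qed

lemma weight_eventually_0:
  assumes "mdeg e < j"
  shows "weight j e = 0"
proof -
  have "expo e i div 2 ^ (j - 1) = 0" for i
  proof (rule div_less)
    have "expo e i \<le> mdeg e" unfolding mdeg_def by (rule member_le_sum) simp_all
    also have "\<dots> \<le> j - 1" using assms by simp
    also have "\<dots> < 2 ^ (j - 1)" by (rule less_exp)
    finally show "expo e i < 2 ^ (j - 1)" .
  qed
  then show ?thesis by (simp add: weight_def)
qed

lemma weights_less_right_total:
  assumes "\<not> weights_eq a b"
  shows "weights_less_right a b \<or> weights_less_right b a"
proof -
  define D where "D = {j. j \<ge> 1 \<and> weight j a \<noteq> weight j b}"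
  have "j \<le> max (mdeg a) (mdeg b)" if "j \<in> D" for j
    using that weight_eventually_0 [of a j] weight_eventually_0 [of b j] by (force simp: D_def)
  then have fin: "finite D" by (meson finite_nat_set_iff_bounded_le)
  have "D \<noteq> {}" using assms by (auto simp: weights_eq_def D_def)
  then have "Max D \<in> D" using fin by simp
  moreover have "\<forall>j>Max D. j \<notin> D"
  proof safe
    fix j assume "Max D < j" "j \<in> D"
    moreover have "j \<le> Max D" using \<open>j \<in> D\<close> by (rule Max_ge [OF fin])
    ultimately show False by simp
  qed
  ultimately obtain m where m: "m \<in> D" "\<forall>j>m. j \<notin> D" by blast
  then have m1: "1 \<le> m" "weight m a \<noteq> weight m b" by (auto simp: D_def)
  then have high: "\<forall>i>m. weight i a = weight i b" using m(2) by (auto simp: D_def)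
  from m1 consider "weight m a < weight m b" | "weight m b < weight m a" by linarith
  then show ?thesis
    unfolding weights_less_right_def
  proof cases
    case 1
    then have "\<exists>j\<ge>1. (\<forall>i>j. weight i b = weight i a) \<and> weight j a < weight j b"
      using m1 high by (intro exI [of _ m]) simp
    then show "(\<exists>j\<ge>1. (\<forall>i>j. weight i a = weight i b) \<and> weight j b < weight j a) \<or>
        (\<exists>j\<ge>1. (\<forall>i>j. weight i b = weight i a) \<and> weight j a < weight j b)" ..
  next
    case 2
    then have "\<exists>j\<ge>1. (\<forall>i>j. weight i a = weight i b) \<and> weight j b < weight j a"
      using m1 high by (intro exI [of _ m]) simp
    then show "(\<exists>j\<ge>1. (\<forall>i>j. weight i a = weight i b) \<and> weight j b < weight j a) \<or>
        (\<exists>j\<ge>1. (\<forall>i>j. weight i b = weight i a) \<and> weight j a < weight j b)" ..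
  qed
qed

lemma weights_eq_refl: "weights_eq a a"
  and weights_eq_sym: "weights_eq a b \<Longrightarrow> weights_eq b a"
  and weights_eq_trans: "weights_eq a b \<Longrightarrow> weights_eq b c \<Longrightarrow> weights_eq a c"
  by (simp_all add: weights_eq_def)

lemma weights_less_left_cong:
  assumes "weights_eq a a'" "weights_eq b b'" "weights_less_left a b"
  shows "weights_less_left a' b'"
proof -
  obtain j where j: "j \<ge> 1" "\<forall>i. 1 \<le> i \<and> i < j \<longrightarrow> weight i a = weight i b" "weight j a < weight j b"
    using assms(3) unfolding weights_less_left_def by blast
  have "weight i a = weight i a'" "weight i b = weight i b'" if "i \<ge> 1" for i
    using assms(1,2) that unfolding weights_eq_def by blast+
  then show ?thesis unfolding weights_less_left_def using j by (intro exI [of _ j]) simp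
qed

lemma weights_less_right_cong:
  assumes "weights_eq a a'" "weights_eq b b'" "weights_less_right a b"
  shows "weights_less_right a' b'"
proof -
  obtain j where j: "j \<ge> 1" "\<forall>i>j. weight i a = weight i b" "weight j a > weight j b"
    using assms(3) unfolding weights_less_right_def by blast
  have "weight i a = weight i a'" "weight i b = weight i b'" if "i \<ge> 1" for i
    using assms(1,2) that unfolding weights_eq_def by blast+
  then show ?thesis unfolding weights_less_right_def using j by (intro exI [of _ j]) simp
qed

lemma left_weight_less_order:
  "irreflp (left_weight_less :: 'k::{finite,linorder} mon \<Rightarrow> _)"
  "transp (left_weight_less :: 'k::{finite,linorder} mon \<Rightarrow> _)"
  "totalp (left_weight_less :: 'k::{finite,linorder} mon \<Rightarrow> _)"
proof -
  have *: "left_weight_less = (\<lambda>a b. weights_less_left a b \<or> weights_eq a b \<and> lex_less a (b :: 'k mon))"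
    by (simp add: fun_eq_iff left_weight_less_def weights_less_left_def weights_eq_def)
  have irr: "irreflp (weights_less_left :: 'k mon \<Rightarrow> _)" by (auto simp: irreflp_def weights_less_left_def)
  have E: "\<And>a b c :: 'k mon. weights_less_left a b \<Longrightarrow> weights_eq b c \<Longrightarrow> weights_less_left a c"
    "\<And>a b c :: 'k mon. weights_eq a b \<Longrightarrow> weights_less_left b c \<Longrightarrow> weights_less_left a c"
    "\<And>a b c :: 'k mon. weights_eq a b \<Longrightarrow> weights_eq b c \<Longrightarrow> weights_eq a c"
    "\<And>a b :: 'k mon. weights_eq a b \<Longrightarrow> weights_eq b a"
    using weights_less_left_cong weights_eq_refl weights_eq_sym weights_eq_trans by blast+
  show "irreflp (left_weight_less :: 'k mon \<Rightarrow> _)" "transp (left_weight_less :: 'k mon \<Rightarrow> _)"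
    "totalp (left_weight_less :: 'k mon \<Rightarrow> _)"
    by (rule tie_break_order [OF irr weights_less_left_trans E weights_less_left_total
      irreflp_lex_less transp_lex_less totalp_lex_less *]; assumption)+
qed

lemma right_weight_less_order:
  "irreflp (right_weight_less :: 'k::{finite,linorder} mon \<Rightarrow> _)"
  "transp (right_weight_less :: 'k::{finite,linorder} mon \<Rightarrow> _)"
  "totalp (right_weight_less :: 'k::{finite,linorder} mon \<Rightarrow> _)"
proof -
  have *: "right_weight_less = (\<lambda>a b. weights_less_right a b \<or> weights_eq a b \<and> lex_less a (b :: 'k mon))"
    by (simp add: fun_eq_iff right_weight_less_def weights_less_right_def weights_eq_def)
  have irr: "irreflp (weights_less_right :: 'k mon \<Rightarrow> _)" by (auto simp: irreflp_def weights_less_right_def)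
  have E: "\<And>a b c :: 'k mon. weights_less_right a b \<Longrightarrow> weights_eq b c \<Longrightarrow> weights_less_right a c"
    "\<And>a b c :: 'k mon. weights_eq a b \<Longrightarrow> weights_less_right b c \<Longrightarrow> weights_less_right a c"
    "\<And>a b c :: 'k mon. weights_eq a b \<Longrightarrow> weights_eq b c \<Longrightarrow> weights_eq a c"
    "\<And>a b :: 'k mon. weights_eq a b \<Longrightarrow> weights_eq b a"
    using weights_less_right_cong weights_eq_refl weights_eq_sym weights_eq_trans by blast+
  show "irreflp (right_weight_less :: 'k mon \<Rightarrow> _)" "transp (right_weight_less :: 'k mon \<Rightarrow> _)"
    "totalp (right_weight_less :: 'k mon \<Rightarrow> _)"
    by (rule tie_break_order [OF irr weights_less_right_trans E weights_less_right_total
      irreflp_lex_less transp_lex_less totalp_lex_less *]; assumption)+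
qed

lemma lead_std_le_tau:
  assumes "finite (rows A)" "finite (cols A)"
  shows "lead_std A \<le> tau A"
  unfolding lead_std_def
  by (simp add: lead_count_le_tau [OF _ _ _ assms] irreflp_lex_less transp_lex_less totalp_lex_less
      irreflp_degrevlex_less transp_degrevlex_less totalp_degrevlex_less
      left_weight_less_order right_weight_less_order)

section \<open>Upper bounds for the rank\<close>

lemma mat_rank_le_nonzero_rows:
  assumes "finite (rows A)"
  shows "mat_rank A \<le> card (nonzero_rows A)"
proof -
  have fin: "finite (nonzero_rows A)" using assms by (simp add: nonzero_rows_def)
  have "mat_col A c \<in> {f. Poly_Mapping.keys f \<subseteq> nonzero_rows A}" if "c \<in> cols A" for c
    using that by (auto simp: in_keys_iff lookup_mat_col [OF assms] Supp_def nonzero_rows_def split: if_splits)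
  then have "F2.span (mat_col A ` cols A) \<subseteq> {f. Poly_Mapping.keys f \<subseteq> nonzero_rows A}"
    by (intro F2.span_minimal f2_keys_subspace) blast
  then have "mat_rank A \<le> F2.dim {f :: _ \<Rightarrow>\<^sub>0 bit. Poly_Mapping.keys f \<subseteq> nonzero_rows A}"
    unfolding mat_rank_def by (intro f2_dim_mono f2_keys_card(1) fin f2_keys_subspace F2.subspace_span)
  then show ?thesis by (simp add: f2_keys_card(2) [OF fin])
qed

lemma mat_rank_le_nonzero_cols:
  assumes "finite (rows A)" "finite (cols A)"
  shows "mat_rank A \<le> card (nonzero_cols A)"
proof -
  have fin: "finite (nonzero_cols A)" using assms by (simp add: nonzero_cols_def)
  have "mat_col A c \<in> F2.span (mat_col A ` nonzero_cols A)" if "c \<in> cols A" for c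
  proof (cases "Supp A c = {}")
    case True
    then have "mat_col A c = 0" by (intro poly_mapping_eqI) (simp add: lookup_mat_col [OF assms(1)])
    then show ?thesis by (simp add: F2.span_zero)
  next
    case False
    then show ?thesis using that by (intro F2.span_base imageI) (simp add: nonzero_cols_def)
  qed
  then have "F2.span (mat_col A ` cols A) \<subseteq> F2.span (mat_col A ` nonzero_cols A)"
    by (intro F2.span_minimal F2.subspace_span) blast
  then have "mat_rank A \<le> card (mat_col A ` nonzero_cols A)"
    unfolding mat_rank_def using fin by (intro F2.dim_le_card) auto
  also have "\<dots> \<le> card (nonzero_cols A)" by (rule card_image_le [OF fin])
  finally show ?thesis .
qed

lemma dual_zero: "\<phi> \<in> dual d \<Longrightarrow> \<phi> 0 = 0"
  by (auto simp: dual_def F2.subspace_0 [OF homog_subspace] dest!: spec [of _ 0] bspec [of _ _ 0])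

text \<open>The transposed squares vanish on \<open>\<phi>\<close>, so \<open>\<phi>\<close> is zero on the generators of the column space.\<close>

lemma dual_kernel_vanishes:
  assumes \<phi>: "\<phi> \<in> dual_kernel d" and x: "x \<in> hit_space d"
  shows "\<phi> x = 0"
proof -
  have dual: "\<phi> \<in> dual d" and zero: "\<And>r. r > 0 \<Longrightarrow> Sq_dual d r \<phi> = 0"
    using \<phi> by (auto simp: dual_kernel_def)
  have add: "\<phi> (f + g) = \<phi> f + \<phi> g" if "f \<in> homog d" "g \<in> homog d" for f g
    using dual that by (auto simp: dual_def)
  have "\<phi> (Sq (2 ^ t) (xpow g)) = 0" if "(t, g) \<in> labels d" for t g
  proof -
    have "\<phi> (Sq (2 ^ t) (xpow g)) = Sq_dual d (2 ^ t) \<phi> (xpow g)"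
      using that by (simp add: Sq_dual_def labels_def)
    then show ?thesis using zero [of "2 ^ t"] by simp
  qed
  then have "(\<lambda>(t, g). Sq (2 ^ t) (xpow g)) ` labels d \<subseteq> {x \<in> homog d. \<phi> x = 0}"
    using Sq_label_homog by auto
  moreover have "F2.subspace {x \<in> homog d. \<phi> x = 0}"
    by (rule f2_subspaceI)
      (auto simp: add dual_zero [OF dual] F2.subspace_0 F2.subspace_add homog_subspace)
  ultimately have "hit_space d \<subseteq> {x \<in> homog d. \<phi> x = 0}"
    unfolding hit_space_def by (rule F2.span_minimal)
  then show ?thesis using x by blast
qed

text \<open>Extend a basis \<open>B\<close> of the column space to a basis \<open>B'\<close> of all polynomials of degree \<open>d\<close>. A functional in
  the dual kernel is determined by its values on the complement of \<open>B\<close> in \<open>B'\<close>, so there are at most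
  \<open>2\<^bsup>|B' - B|\<^esup>\<close> of them.\<close>

lemma dim_dual_kernel:
  fixes L :: "('k::finite mpol \<Rightarrow> bit) set"
  assumes L: "F2.subspace L" "L \<subseteq> dual_kernel d"
  shows "F2.dim L + F2.dim (hit_space d :: 'k mpol set) \<le> F2.dim (homog d :: 'k mpol set)"
proof -
  let ?H = "hit_space d :: 'k mpol set" and ?P = "homog d :: 'k mpol set"
  obtain B where B: "B \<subseteq> ?H" "\<not> F2.dependent B" "?H \<subseteq> F2.span B" "card B = F2.dim ?H"
    using F2.basis_exists by blast
  have "B \<subseteq> ?P" using B(1) hit_space_subset_homog by blast
  then obtain B' where B': "B \<subseteq> B'" "B' \<subseteq> ?P" "\<not> F2.dependent B'" "?P \<subseteq> F2.span B'"
    using F2.maximal_independent_subset_extend B(2) by metis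
  have fB': "finite B'" using B'(2) homog_finite finite_subset by blast
  have cB': "card B' = F2.dim ?P" using B' by (intro F2.basis_card_eq_dim)
  let ?r = "\<lambda>\<phi>. {b \<in> B' - B. \<phi> b = (1 :: bit)}"
  have inj: "inj_on ?r L"
  proof (rule inj_onI)
    fix \<phi> \<psi> assume "\<phi> \<in> L" "\<psi> \<in> L" and eq: "?r \<phi> = ?r \<psi>"
    then have k: "\<phi> \<in> dual_kernel d" "\<psi> \<in> dual_kernel d" using L(2) by auto
    then have dual: "\<phi> \<in> dual d" "\<psi> \<in> dual d" by (auto simp: dual_kernel_def)
    have "\<phi> b = \<psi> b" if "b \<in> B'" for b
    proof (cases "b \<in> B")
      case True
      then show ?thesis using B(1) dual_kernel_vanishes k by (metis subsetD)
    next
      case False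
      then have "\<phi> b = 1 \<longleftrightarrow> \<psi> b = 1" using eq that by blast
      then show ?thesis by (cases "\<phi> b"; cases "\<psi> b") auto
    qed
    then have "B' \<subseteq> {x \<in> ?P. \<phi> x = \<psi> x}" using B'(2) by auto
    moreover have "F2.subspace {x \<in> ?P. \<phi> x = \<psi> x}"
    proof (rule f2_subspaceI)
      fix x y assume "x \<in> {x \<in> ?P. \<phi> x = \<psi> x}" "y \<in> {x \<in> ?P. \<phi> x = \<psi> x}"
      moreover from this have "\<phi> (x + y) = \<phi> x + \<phi> y" "\<psi> (x + y) = \<psi> x + \<psi> y"
        using dual by (auto simp: dual_def)
      ultimately show "x + y \<in> {x \<in> ?P. \<phi> x = \<psi> x}"
        by (auto simp: F2.subspace_add homog_subspace)
    qed (simp add: dual_zero [OF dual(1)] dual_zero [OF dual(2)] F2.subspace_0 homog_subspace)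
    ultimately have "F2.span B' \<subseteq> {x \<in> ?P. \<phi> x = \<psi> x}" by (rule F2.span_minimal)
    then have "\<phi> x = \<psi> x" if "x \<in> ?P" for x using B'(4) that by blast
    moreover have "\<phi> x = \<psi> x" if "x \<notin> ?P" for x using dual that by (simp add: dual_def)
    ultimately show "\<phi> = \<psi>" by blast
  qed
  have sub: "?r ` L \<subseteq> Pow (B' - B)" by blast
  have finP: "finite (Pow (B' - B))" using fB' by simp
  have finL: "finite L" using finite_subset [OF sub finP] inj by (rule finite_imageD)
  have "card L \<le> card (Pow (B' - B))" using card_inj_on_le [OF inj sub finP] .
  then have "card L \<le> 2 ^ card (B' - B)" using fB' by (simp add: card_Pow)
  then have "F2.dim L \<le> card (B' - B)" by (rule f2_dim_leI [OF finL L(1)])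
  moreover have "card (B' - B) = card B' - card B" "card B \<le> card B'"
    using B'(1) fB' by (auto intro: card_Diff_subset card_mono finite_subset)
  ultimately show ?thesis using B(4) cB' by simp
qed

section \<open>The column bound corrected by relations\<close>

lemma single_eq_sum:
  "finite A \<Longrightarrow> Poly_Mapping.single t (\<Sum>i\<in>A. f i) = (\<Sum>i\<in>A. Poly_Mapping.single t (f i :: 'a::f2_space))"
  by (induction rule: finite_induct) (simp_all add: single_add)

lemma label_vec_in_hit_domain:
  assumes "(t, g) \<in> labels d"
  shows "label_vec (t, g) \<in> hit_domain d"
  using assms F2.subspace_0 [OF homog_subspace]
  by (auto simp: hit_domain_def labels_def label_vec_def lookup_single when_def)

lemma hit_domain_subspace: "F2.subspace (hit_domain d)"
  by (rule f2_subspaceI)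
    (auto simp: hit_domain_def lookup_add F2.subspace_0 F2.subspace_add homog_subspace)

lemma hit_domain_eq_span: "hit_domain d = F2.span (label_vec ` labels d)"
proof (intro equalityI subsetI)
  fix v :: "nat \<Rightarrow>\<^sub>0 'a mpol" assume v: "v \<in> hit_domain d"
  have "v = (\<Sum>t\<in>Poly_Mapping.keys v. Poly_Mapping.single t (Poly_Mapping.lookup v t))"
    by (rule poly_mapping_eqI) (simp add: lookup_sum lookup_single when_def in_keys_iff)
  also have "\<dots> \<in> F2.span (label_vec ` labels d)"
  proof (rule F2.span_sum)
    fix t assume t: "t \<in> Poly_Mapping.keys v"
    let ?f = "Poly_Mapping.lookup v t"
    have f: "2 ^ t \<le> d" "?f \<in> homog (d - 2 ^ t)"
      using v t by (auto simp: hit_domain_def in_keys_iff split: if_splits dest!: spec [of _ t])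
    have "Poly_Mapping.single t ?f = (\<Sum>e\<in>Poly_Mapping.keys ?f. label_vec (t, e))"
      unfolding label_vec_def prod.case by (subst pm_expand_xpow) (simp add: single_eq_sum)
    also have "\<dots> \<in> F2.span (label_vec ` labels d)"
      by (intro F2.span_sum F2.span_base imageI) (use f in \<open>auto simp: labels_def homog_def\<close>)
    finally show "Poly_Mapping.single t ?f \<in> F2.span (label_vec ` labels d)" .
  qed
  finally show "v \<in> F2.span (label_vec ` labels d)" .
next
  fix v :: "nat \<Rightarrow>\<^sub>0 'a mpol" assume "v \<in> F2.span (label_vec ` labels d)"
  moreover have "label_vec ` labels d \<subseteq> (hit_domain d :: (nat \<Rightarrow>\<^sub>0 'a mpol) set)"
    using label_vec_in_hit_domain by auto
  ultimately show "v \<in> hit_domain d"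
    using F2.span_minimal [OF _ hit_domain_subspace] by blast
qed

lemma hit_domain_finite: "finite (hit_domain d :: (nat \<Rightarrow>\<^sub>0 'k::finite mpol) set)"
  unfolding hit_domain_eq_span by (intro f2_finite_span finite_imageI finite_labels)

lemma hit_map_image: "hit_map ` hit_domain d = hit_space d"
proof -
  have "hit_map ` hit_domain d = F2.span (hit_map ` label_vec ` labels d)"
    unfolding hit_domain_eq_span by (rule additive_span_image [OF additive_hit_map])
  also have "hit_map ` label_vec ` labels d = (\<lambda>(t, g). Sq (2 ^ t) (xpow g)) ` labels d"
    unfolding image_image by (rule image_cong) auto
  finally show ?thesis by (simp add: hit_space_def)
qed

definition hit_kernel :: "nat \<Rightarrow> (nat \<Rightarrow>\<^sub>0 'k::finite mpol) set" where
  "hit_kernel d = {v \<in> hit_domain d. hit_map v = 0}"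

lemma hit_kernel_subspace: "F2.subspace (hit_kernel d)"
  by (rule f2_subspaceI)
    (auto simp: hit_kernel_def additive.zero [OF additive_hit_map] additive.add [OF additive_hit_map]
      F2.subspace_0 F2.subspace_add hit_domain_subspace)

lemma hit_kernel_finite: "finite (hit_kernel d :: (nat \<Rightarrow>\<^sub>0 'k::finite mpol) set)"
  by (rule finite_subset [OF _ hit_domain_finite [of d]]) (auto simp: hit_kernel_def)

lemma lookup_Psi_map: "Poly_Mapping.lookup (Psi_map \<Theta> f) t = act (Poly_Mapping.lookup \<Theta> t) f"
  by (simp add: Psi_map_def map.rep_eq when_def)

text \<open>The hit map sends the image of \<open>f\<close> to \<open>(\<Sum>\<^sub>t Sq\<^bsup>2^t\<^esup> \<Theta>\<^sub>t) f\<close>, where the sum is zero in the Steenrod algebra.\<close>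

lemma relation_image_kernel:
  assumes rel: "homogeneous_relation a \<Theta>" and f: "f \<in> homog (d - a)" and ad: "a \<le> d"
  shows "Psi_map \<Theta> f \<in> hit_kernel d"
proof -
  have "Poly_Mapping.lookup (Psi_map \<Theta> f) t \<in> (if 2 ^ t \<le> d then homog (d - 2 ^ t) else {0})" for t
  proof (cases "t \<in> Poly_Mapping.keys \<Theta>")
    case True
    then have t: "2 ^ t \<le> a" "Poly_Mapping.lookup \<Theta> t \<in> steenrod_homog (a - 2 ^ t)"
      using rel by (auto simp: homogeneous_relation_def)
    have "d - a + (a - 2 ^ t) = d - 2 ^ t" "2 ^ t \<le> d" using t(1) ad by auto
    then show ?thesis using act_homog [OF t(2) f] by (simp add: lookup_Psi_map)
  next
    case False
    then show ?thesis by (simp add: lookup_Psi_map in_keys_iff F2.subspace_0 homog_subspace)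
  qed
  then have dom: "Psi_map \<Theta> f \<in> hit_domain d" by (simp add: hit_domain_def)
  have "hit_map (Psi_map \<Theta> f) = (\<Sum>t\<in>Poly_Mapping.keys \<Theta>. Sq (2 ^ t) (Poly_Mapping.lookup (Psi_map \<Theta> f) t))"
    by (rule hit_map_superset) (auto simp: in_keys_iff lookup_Psi_map)
  also have "\<dots> = (\<Sum>t\<in>Poly_Mapping.keys \<Theta>. act (SqA (2 ^ t) * Poly_Mapping.lookup \<Theta> t) f)"
    by (simp add: lookup_Psi_map act_mult)
  also have "\<dots> = act (\<Sum>t\<in>Poly_Mapping.keys \<Theta>. SqA (2 ^ t) * Poly_Mapping.lookup \<Theta> t) f"
    by (rule additive.sum [OF additive_act_left, symmetric])
  also have "\<dots> = 0" using rel by (simp add: homogeneous_relation_def)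
  finally show ?thesis using dom by (simp add: hit_kernel_def)
qed

lemma Psi_map_Theta1: "Psi_map Theta1 f = Poly_Mapping.single 0 (Sq 1 f)"
  by (rule poly_mapping_eqI) (auto simp: lookup_Psi_map Theta1_def lookup_single when_def)

lemma im_Psi_Theta1: "im_Psi d (2, Theta1) = (if 2 \<le> d then (\<lambda>f. Poly_Mapping.single 0 (Sq 1 f)) ` homog (d - 2) else {0})"
  by (simp add: im_Psi_def Psi_map_Theta1 del: One_nat_def)

lemma F1_subset_kernel: "(F1 d :: (nat \<Rightarrow>\<^sub>0 'k::finite mpol) set) \<subseteq> hit_kernel d"
proof -
  have "(E0 d :: (nat \<Rightarrow>\<^sub>0 'k mpol) set) \<subseteq> hit_kernel d"
    unfolding E0_def
    by (intro F2.span_minimal hit_kernel_subspace)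
      (auto simp: hit_kernel_def label_vec_in_hit_domain)
  moreover have "im_Psi d (2, Theta1) \<subseteq> (hit_kernel d :: (nat \<Rightarrow>\<^sub>0 'k mpol) set)"
  proof (cases "2 \<le> d")
    case True
    have "Poly_Mapping.single 0 (Sq 1 f) \<in> hit_kernel d" if f: "f \<in> homog (d - 2)" for f :: "'k mpol"
    proof -
      have "Sq 1 f \<in> homog (d - 2 + 1)" using f by (rule Sq_homog)
      moreover have "d - 2 + 1 = d - 1" using True by simp
      ultimately have "Sq 1 f \<in> homog (d - 1)" by (simp only:)
      then have "Poly_Mapping.single 0 (Sq 1 f) \<in> hit_domain d"
        using True F2.subspace_0 [OF homog_subspace]
        by (auto simp: hit_domain_def lookup_single when_def)
      moreover have "hit_map (Poly_Mapping.single 0 (Sq 1 f)) = 0"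
        unfolding hit_map_single power_0 by (rule Sq_1_Sq_1)
      ultimately show ?thesis by (simp add: hit_kernel_def)
    qed
    then show ?thesis using True unfolding im_Psi_Theta1 by auto
  next
    case False
    then show ?thesis
      unfolding im_Psi_Theta1 by (simp add: F2.subspace_0 hit_kernel_subspace)
  qed
  ultimately show ?thesis
    unfolding F1_def by (intro F2.span_minimal hit_kernel_subspace) blast
qed

lemma K_rel_subset_kernel:
  assumes "\<forall>(a, \<Theta>)\<in>R. homogeneous_relation a \<Theta>"
  shows "K_rel R d \<subseteq> hit_kernel d"
proof -
  have "im_Psi d x \<subseteq> hit_kernel d" if "x \<in> R" for x
    using that assms relation_image_kernel [of "fst x" "snd x" _ d]
    by (cases x) (auto simp: im_Psi_def F2.subspace_0 hit_kernel_subspace)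
  then show ?thesis
    unfolding K_rel_def by (intro F2.span_minimal hit_kernel_subspace) blast
qed

lemma E0_subset_F1: "E0 d \<subseteq> F1 d"
  and im_Psi_Theta1_subset_F1: "im_Psi d (2, Theta1) \<subseteq> F1 d"
  unfolding F1_def using F2.span_superset by blast+

text \<open>In positive degree the kernel of the first square is its image; in degree zero it is spanned by
  the monomial one, which belongs to \<open>E0\<close>.\<close>

lemma ker_Sq_1_in_F1:
  fixes u :: "'k::{finite,linorder} mpol"
  assumes u: "u \<in> homog (d - 1)" "Sq 1 u = 0" and d: "d > 0"
  shows "Poly_Mapping.single 0 u \<in> F1 d"
proof (cases "d = 1")
  case True
  have "Poly_Mapping.single 0 u = (\<Sum>e\<in>Poly_Mapping.keys u. label_vec (0, e))"
    unfolding label_vec_def prod.case by (subst pm_expand_xpow) (simp add: single_eq_sum)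
  also have "\<dots> \<in> E0 d"
    unfolding E0_def
  proof (intro F2.span_sum F2.span_base imageI)
    fix e assume "e \<in> Poly_Mapping.keys u"
    then have "e = 0" using u(1) True by (auto simp: homog_def)
    then show "(0, e) \<in> {(t, g). (t, g) \<in> labels d \<and> Sq (2 ^ t) (xpow g) = 0}"
      using True by (simp add: labels_def Sq_one)
  qed
  finally show ?thesis using E0_subset_F1 by blast
next
  case False
  then have "d - 1 > 0" using d by simp
  from ker_Sq_1 [OF u(1) this u(2)] obtain w where w: "w \<in> homog (d - 1 - 1)" "u = Sq 1 w" by blast
  have "d - 1 - 1 = d - 2" "2 \<le> d" using False d by auto
  then have "Poly_Mapping.single 0 u \<in> im_Psi d (2, Theta1)"
    unfolding im_Psi_Theta1 using w by auto
  then show ?thesis using im_Psi_Theta1_subset_F1 by blast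
qed

text \<open>The labels counted by the sum in \<open>W1\<close>.\<close>

definition active_labels :: "nat \<Rightarrow> (nat \<times> 'k::finite mon) set" where
  "active_labels d = {(t, g) \<in> labels d. 1 \<le> t \<and> Sq (2 ^ t) (xpow g) \<noteq> 0}"

lemma W1_eq: "W1 TYPE('k::finite) d = int (rho TYPE('k) (d - 1)) + int (card (active_labels d :: (nat \<times> 'k mon) set))"
proof -
  let ?T = "{t. 1 \<le> t \<and> 2 ^ t \<le> d}"
  let ?G = "\<lambda>t. {g :: 'k mon. mdeg g = d - 2 ^ t}" and ?Z = "\<lambda>t. {g :: 'k mon. mdeg g = d - 2 ^ t \<and> Sq (2 ^ t) (xpow g) = 0}"
  have finT: "finite ?T"
  proof (rule finite_subset)
    show "?T \<subseteq> {..d}"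
    proof
      fix t assume "t \<in> ?T"
      then have le: "2 ^ t \<le> d" by simp
      have "t < d" by (rule less_le_trans [OF less_exp le])
      then show "t \<in> {..d}" by simp
    qed
  qed simp
  have "(active_labels d :: (nat \<times> 'k mon) set) = (SIGMA t:?T. ?G t - ?Z t)"
    by (auto simp: active_labels_def labels_def)
  then have "card (active_labels d :: (nat \<times> 'k mon) set) = (\<Sum>t\<in>?T. card (?G t - ?Z t))"
    using finT by (simp add: card_SigmaI finite_mdeg)
  moreover have "int (card (?G t - ?Z t)) = int (dimP TYPE('k) (d - 2 ^ t)) - int (zero_count TYPE('k) t (d - 2 ^ t))" for t
  proof -
    have sub: "?Z t \<subseteq> ?G t" by auto
    moreover have "finite (?Z t)" using finite_mdeg by (rule finite_subset [OF sub])
    ultimately have "card (?G t - ?Z t) = card (?G t) - card (?Z t)" "card (?Z t) \<le> card (?G t)"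
      using finite_mdeg by (auto intro: card_Diff_subset card_mono)
    then show ?thesis by (simp add: dimP_def dim_homog zero_count_def)
  qed
  ultimately show ?thesis by (simp add: W1_def)
qed

text \<open>Modulo \<open>F1\<close>, labels with \<open>Sq\<^bsup>2^t\<^esup> g = 0\<close> vanish and, for \<open>t = 0\<close>, so does the kernel of \<open>Sq\<^sup>1\<close>. Hence
  the domain is generated modulo \<open>F1\<close> by the active labels and by preimages \<open>s b\<close> of a basis \<open>B\<close> of the
  image of \<open>Sq\<^sup>1\<close>.\<close>

lemma dim_hit_domain_le:
  assumes d: "d > 0"
  shows "F2.dim (hit_domain d :: (nat \<Rightarrow>\<^sub>0 'k::{finite,linorder} mpol) set)
    \<le> F2.dim (F1 d :: (nat \<Rightarrow>\<^sub>0 'k mpol) set) + (rho TYPE('k) (d - 1) + card (active_labels d :: (nat \<times> 'k mon) set))"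
proof -
  let ?I = "Sq 1 ` (homog (d - 1) :: 'k mpol set)" and ?F = "F1 d :: (nat \<Rightarrow>\<^sub>0 'k mpol) set"
  obtain B where B: "B \<subseteq> ?I" "?I \<subseteq> F2.span B" "card B = F2.dim ?I"
    using F2.basis_exists [of ?I] by metis
  have "finite ?I" using homog_finite by (rule finite_imageI)
  then have fB: "finite B" using B(1) finite_subset by blast
  have "\<forall>b\<in>B. \<exists>f. f \<in> homog (d - 1) \<and> Sq 1 f = b" using B(1) by blast
  then obtain s where s: "\<And>b. b \<in> B \<Longrightarrow> s b \<in> homog (d - 1)" "\<And>b. b \<in> B \<Longrightarrow> Sq 1 (s b) = b"
    by metis
  define S1 where "S1 = (\<lambda>b. Poly_Mapping.single (0::nat) (s b)) ` B"
  define S2 where "S2 = label_vec ` (active_labels d :: (nat \<times> 'k mon) set)"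
  have finA: "finite (active_labels d :: (nat \<times> 'k mon) set)"
    by (rule finite_subset [OF _ finite_labels [of d]]) (auto simp: active_labels_def)
  have gen: "label_vec (t, g) \<in> F2.span (?F \<union> (S1 \<union> S2))" if tg: "(t, g) \<in> labels d" for t and g :: "'k mon"
  proof -
    consider (zero) "Sq (2 ^ t) (xpow g) = 0" | (active) "(t, g) \<in> active_labels d" | (first) "t = 0"
      using tg by (fastforce simp: active_labels_def)
    then show ?thesis
    proof cases
      case zero
      then have "label_vec (t, g) \<in> E0 d"
        unfolding E0_def using tg by (intro F2.span_base imageI) simp
      then show ?thesis using E0_subset_F1 by (intro F2.span_base) blast
    next
      case active
      then show ?thesis by (intro F2.span_base) (simp add: S2_def)
    next
      case first
      have g: "xpow g \<in> homog (d - 1)" using tg first by (simp add: labels_def)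
      then have "Sq 1 (xpow g) \<in> F2.span B" using B(2) by blast
      then obtain T where T: "T \<subseteq> B" "Sq 1 (xpow g) = \<Sum>T"
        unfolding f2_span_subset_sums [OF fB] by blast
      have fT: "finite T" using T(1) fB finite_subset by blast
      define u where "u = xpow g + (\<Sum>b\<in>T. s b)"
      have "Sq 1 u = Sq 1 (xpow g) + (\<Sum>b\<in>T. Sq 1 (s b))"
        by (simp only: u_def Sq_add additive.sum [OF additive_Sq])
      also have "(\<Sum>b\<in>T. Sq 1 (s b)) = \<Sum>T"
        using T(1) s(2) by (intro sum.cong refl) blast
      finally have "Sq 1 u = 0" using T(2) by simp
      moreover have "u \<in> homog (d - 1)"
        unfolding u_def by (intro F2.subspace_add [OF homog_subspace] g F2.subspace_sum [OF homog_subspace])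
          (use T(1) s(1) in blast)
      ultimately have "Poly_Mapping.single 0 u \<in> ?F" using ker_Sq_1_in_F1 d by blast
      moreover have "(\<Sum>b\<in>T. Poly_Mapping.single 0 (s b)) \<in> F2.span (?F \<union> (S1 \<union> S2))"
        by (intro F2.span_sum F2.span_base) (use T(1) in \<open>auto simp: S1_def\<close>)
      ultimately have "Poly_Mapping.single 0 u + (\<Sum>b\<in>T. Poly_Mapping.single 0 (s b)) \<in> F2.span (?F \<union> (S1 \<union> S2))"
        by (intro F2.span_add) (auto intro: F2.span_base)
      moreover have "Poly_Mapping.single 0 u + (\<Sum>b\<in>T. Poly_Mapping.single 0 (s b)) = label_vec (t, g)"
        by (simp add: u_def single_add single_eq_sum fT label_vec_def first add.assoc)
      ultimately show ?thesis by simp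
    qed
  qed
  have "F2.dim (hit_domain d :: (nat \<Rightarrow>\<^sub>0 'k mpol) set) \<le> F2.dim (F2.span ?F) + card (S1 \<union> S2)"
  proof (rule f2_dim_span_Un_le)
    show "finite ?F" using F1_subset_kernel hit_kernel_finite finite_subset by blast
    show "finite (S1 \<union> S2)" using fB finA by (simp add: S1_def S2_def)
    show "hit_domain d \<subseteq> F2.span (?F \<union> (S1 \<union> S2))"
      unfolding hit_domain_eq_span by (intro F2.span_minimal F2.subspace_span) (use gen in auto)
  qed (rule hit_domain_subspace)
  also have "card (S1 \<union> S2) \<le> card S1 + card S2" by (rule card_Un_le)
  also have "card S1 \<le> rho TYPE('k) (d - 1)"
    using card_image_le [OF fB, of "\<lambda>b. Poly_Mapping.single (0::nat) (s b)"] B(3) by (simp add: S1_def rho_def)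
  also have "card S2 \<le> card (active_labels d :: (nat \<times> 'k mon) set)"
    unfolding S2_def by (rule card_image_le [OF finA])
  finally show ?thesis by simp
qed

text \<open>The rank is \<open>dim V - dim ker\<close>. The kernel contains \<open>F1 + K\<close>, of dimension \<open>dim F1 + \<delta>\<close>, and
  \<open>dim V - dim F1\<close> is at most \<open>W1\<close>.\<close>

lemma mat_rank_le_W1_delta1:
  assumes d: "d > 0" and R: "\<forall>(a, \<Theta>)\<in>R. homogeneous_relation a \<Theta>"
  shows "int (mat_rank (hit_matrix d :: ('k::{finite,linorder} mon, nat \<times> 'k mon) lmatrix))
    \<le> W1 TYPE('k) d - delta1 TYPE('k) R d"
proof -
  let ?V = "hit_domain d :: (nat \<Rightarrow>\<^sub>0 'k mpol) set" and ?K = "hit_kernel d :: (nat \<Rightarrow>\<^sub>0 'k mpol) set"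
  let ?G = "F2.span (F1 d \<union> K_rel R d) :: (nat \<Rightarrow>\<^sub>0 'k mpol) set"
  have "?G \<subseteq> ?K"
    by (intro F2.span_minimal hit_kernel_subspace) (use F1_subset_kernel K_rel_subset_kernel [OF R] in blast)
  then have "F2.dim ?G \<le> F2.dim ?K"
    by (intro f2_dim_mono hit_kernel_finite hit_kernel_subspace F2.subspace_span)
  moreover have "F2.dim ?V = F2.dim ?K + F2.dim (hit_space d :: 'k mpol set)"
    using f2_rank_nullity [OF additive_hit_map hit_domain_finite hit_domain_subspace]
    unfolding hit_kernel_def hit_map_image .
  ultimately show ?thesis
    using dim_hit_domain_le [OF d, where 'k = 'k]
    unfolding mat_rank_hit_matrix W1_eq delta1_def by linarith
qed

section \<open>Assembling the bounds\<close>

lemma finite_hit_matrix: "finite (rows (hit_matrix d))" "finite (cols (hit_matrix d))"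
  by (simp_all add: hit_matrix_def finite_mdeg finite_labels)

lemma finite_reduced_matrix: "finite (rows (reduced_matrix d))" "finite (cols (reduced_matrix d))"
proof -
  show "finite (rows (reduced_matrix d))" by (simp add: reduced_matrix_def finite_first_odd)
  show "finite (cols (reduced_matrix d))"
    by (rule finite_subset [OF _ finite_labels [of d]]) (auto simp: reduced_matrix_def)
qed

lemma L_eval_le_L_opt: "L_eval TYPE('k::{finite,linorder}) d \<le> L_opt TYPE('k) d"
proof -
  have "lead_std (hit_matrix d :: ('k mon, nat \<times> 'k mon) lmatrix) \<le> tau (hit_matrix d :: ('k mon, nat \<times> 'k mon) lmatrix)"
    by (intro lead_std_le_tau finite_hit_matrix)
  moreover have "lead_std (reduced_matrix d :: ('k mon, nat \<times> 'k mon) lmatrix) \<le> tau (reduced_matrix d :: ('k mon, nat \<times> 'k mon) lmatrix)"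
    by (intro lead_std_le_tau finite_reduced_matrix)
  ultimately show ?thesis by (auto simp: L_eval_def L_opt_def)
qed

lemma L_opt_le_rank:
  "L_opt TYPE('k::{finite,linorder}) d \<le> mat_rank (hit_matrix d :: ('k mon, nat \<times> 'k mon) lmatrix)"
proof -
  have "tau (hit_matrix d :: ('k mon, nat \<times> 'k mon) lmatrix) \<le> mat_rank (hit_matrix d :: ('k mon, nat \<times> 'k mon) lmatrix)"
    by (intro tau_le_rank finite_hit_matrix)
  moreover have "tau (reduced_matrix d :: ('k mon, nat \<times> 'k mon) lmatrix) \<le> mat_rank (reduced_matrix d :: ('k mon, nat \<times> 'k mon) lmatrix)"
    by (intro tau_le_rank finite_reduced_matrix)
  ultimately show ?thesis using mat_rank_hit_reduced [of d, where 'k = 'k] by (auto simp: L_opt_def)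
qed

lemma mat_rank_le_U_bound:
  fixes L :: "('k::{finite,linorder} mpol \<Rightarrow> bit) set"
  assumes "d > 0 \<Longrightarrow> F2.subspace L \<and> L \<subseteq> dual_kernel d"
    and "d > 0 \<Longrightarrow> \<forall>(a, \<Theta>)\<in>R. homogeneous_relation a \<Theta>"
  shows "int (mat_rank (hit_matrix d :: ('k mon, nat \<times> 'k mon) lmatrix)) \<le> U_bound L R d"
proof (cases "d = 0")
  case True
  then have "cols (hit_matrix d :: ('k mon, nat \<times> 'k mon) lmatrix) = {}"
    by (simp add: hit_matrix_def labels_def)
  then have "mat_rank (hit_matrix d :: ('k mon, nat \<times> 'k mon) lmatrix) \<le> card ({} :: 'k mpol set)"
    unfolding mat_rank_def by (intro F2.dim_le_card) auto
  then show ?thesis using True by (simp add: U_bound_def)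
next
  case False
  let ?M = "hit_matrix d :: ('k mon, nat \<times> 'k mon) lmatrix" and ?N = "reduced_matrix d :: ('k mon, nat \<times> 'k mon) lmatrix"
  have d: "d > 0" using False by simp
  have "int (mat_rank ?M) \<le> int (dimP TYPE('k) d) - int (F2.dim L)"
    using dim_dual_kernel [of L d] assms(1) [OF d] by (simp add: mat_rank_hit_matrix dimP_def)
  moreover have "int (mat_rank ?M) \<le> W1 TYPE('k) d - delta1 TYPE('k) R d"
    using d assms(2) by (intro mat_rank_le_W1_delta1) blast+
  moreover have "int (mat_rank ?M) \<le> int (rho TYPE('k) (d - 1)) + int (min (card (nonzero_rows ?N)) (card (nonzero_cols ?N)))"
    using mat_rank_hit_reduced [OF d, where 'k = 'k]
      mat_rank_le_nonzero_rows [of ?N, OF finite_reduced_matrix(1)]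
      mat_rank_le_nonzero_cols [of ?N, OF finite_reduced_matrix] by simp
  ultimately show ?thesis using False by (simp add: U_bound_def)
qed

theorem theorem6p1:
  fixes d :: nat
    and L :: "('k::{finite,linorder} mpol \<Rightarrow> bit) set"
    and R :: "(nat \<times> (nat \<Rightarrow>\<^sub>0 steenrod)) set"
  assumes "d > 0 \<Longrightarrow> F2.subspace L \<and> L \<subseteq> dual_kernel d"
    and "d > 0 \<Longrightarrow> finite R \<and> (\<forall>(a, \<Theta>)\<in>R. homogeneous_relation a \<Theta>)"
  shows "L_eval TYPE('k) d \<le> L_opt TYPE('k) d
    \<and> L_opt TYPE('k) d \<le> mat_rank (hit_matrix d :: ('k mon, nat \<times> 'k mon) lmatrix)
    \<and> int (mat_rank (hit_matrix d :: ('k mon, nat \<times> 'k mon) lmatrix)) \<le> U_bound L R d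
    \<and> int (dimP TYPE('k) d) - U_bound L R d \<le> int (F2.dim (cohits_deg d :: 'k cohits set))
    \<and> int (F2.dim (cohits_deg d :: 'k cohits set)) \<le> int (dimP TYPE('k) d) - int (L_opt TYPE('k) d)
    \<and> int (dimP TYPE('k) d) - int (L_opt TYPE('k) d) \<le> int (dimP TYPE('k) d) - int (L_eval TYPE('k) d)
    \<and> F2.dim (cohits_deg 0 :: 'k cohits set) = 1"
proof -
  have quot: "dimP TYPE('k) n = mat_rank (hit_matrix n :: ('k mon, nat \<times> 'k mon) lmatrix)
      + F2.dim (cohits_deg n :: 'k cohits set)" for n
    unfolding dimP_def mat_rank_hit_matrix by (rule dim_cohits)
  have U: "int (mat_rank (hit_matrix d :: ('k mon, nat \<times> 'k mon) lmatrix)) \<le> U_bound L R d"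
    using assms by (intro mat_rank_le_U_bound) blast+
  have "dimP TYPE('k) 0 = 1"
  proof -
    have "{e :: 'k mon. mdeg e = 0} = {0}" by auto
    then show ?thesis by (simp add: dimP_def dim_homog)
  qed
  moreover have "int (mat_rank (hit_matrix 0 :: ('k mon, nat \<times> 'k mon) lmatrix))
      \<le> U_bound ({} :: ('k mpol \<Rightarrow> bit) set) {} 0"
    by (rule mat_rank_le_U_bound) simp_all
  ultimately have "F2.dim (cohits_deg 0 :: 'k cohits set) = 1"
    using quot [of 0] by (simp add: U_bound_def)
  then show ?thesis
    using L_eval_le_L_opt [of d, where 'k = 'k] L_opt_le_rank [of d, where 'k = 'k] U quot [of d] by auto
qed

end
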